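(* Let $f$ be an operator convex function on $(0,\infty)$ with $f(0^+)<\infty$, extended to $[0,\infty)$ by $f(0):=f(0^+)$. Let $A,B$ be bounded positive operators with $A\le cB$ for some $c>0$. Then for any sequence $L_n$ of bounded positive invertible operators with $\|L_n\|_\infty\to0$, $$\lim_{n\to\infty}P_f(A,B+L_n)=\lim_{\varepsilon\searrow0}P_f(A,B+\varepsilon I)=B^{1/2}f(D(A/B))B^{1/2}$$ in the strong operator topology.
   Context: For $A\ge0$ bounded positive and $B$ bounded positive invertible, $P_f(A,B):=B^{1/2}f(B^{-1/2}AB^{-1/2})B^{1/2}$ (well defined with $f$ extended continuously to $[0,\infty)$). For bounded positive $A,B$ with $A\le cB$, $D(A/B)$ is the unique bounded positive $W$ with $W(I-s(B))=0$ and $A=B^{1/2}WB^{1/2}$, $s(B)$ being the orthogonal projection onto the closure of the range of $B$. *)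

theory Defs
  imports "HOL-Analysis.Analysis" "Jordan_Normal_Form.Matrix" "Jordan_Normal_Form.Char_Poly"
    "Jordan_Normal_Form.Schur_Decomposition"
begin

definition mat_hermitian :: "complex mat \<Rightarrow> bool" where
  "mat_hermitian M \<longleftrightarrow> M \<in> carrier_mat (dim_row M) (dim_row M) \<and> mat_adjoint M = M"

definition mat_psd :: "complex mat \<Rightarrow> bool" where
  "mat_psd M \<longleftrightarrow> mat_hermitian M \<and>
     (\<forall>v \<in> carrier_vec (dim_row M). 0 \<le> Re ((M *\<^sub>v v) \<bullet>c v))"

definition mat_pd :: "complex mat \<Rightarrow> bool" where
  "mat_pd M \<longleftrightarrow> mat_hermitian M \<and>
     (\<forall>v \<in> carrier_vec (dim_row M). v \<noteq> 0\<^sub>v (dim_row M) \<longrightarrow> 0 < Re ((M *\<^sub>v v) \<bullet>c v))"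

definition mat_poly :: "complex poly \<Rightarrow> complex mat \<Rightarrow> complex mat" where
  "mat_poly p M = mat (dim_row M) (dim_row M)
     (\<lambda>(i,j). \<Sum>k\<le>degree p. coeff p k * (M ^\<^sub>m k) $$ (i,j))"

text \<open>functional calculus for Hermitian matrices: f(M) = p(M) for any polynomial p
  interpolating f on the (real) eigenvalues of M\<close>
definition mat_fc :: "(real \<Rightarrow> real) \<Rightarrow> complex mat \<Rightarrow> complex mat" where
  "mat_fc f M = (THE X. \<forall>p. (\<forall>k. eigenvalue M k \<longrightarrow> poly p k = complex_of_real (f (Re k)))
                       \<longrightarrow> mat_poly p M = X)"

definition operator_convex_pos :: "(real \<Rightarrow> real) \<Rightarrow> bool" where
  "operator_convex_pos f \<longleftrightarrow>
    (\<forall>n A B t. A \<in> carrier_mat n n \<longrightarrow> B \<in> carrier_mat n n \<longrightarrow> mat_pd A \<longrightarrow> mat_pd B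
       \<longrightarrow> 0 \<le> t \<longrightarrow> t \<le> 1 \<longrightarrow>
       mat_psd (complex_of_real t \<cdot>\<^sub>m mat_fc f A + complex_of_real (1 - t) \<cdot>\<^sub>m mat_fc f B
                - mat_fc f (complex_of_real t \<cdot>\<^sub>m A + complex_of_real (1 - t) \<cdot>\<^sub>m B)))"

definition selfadj :: "('a::real_inner \<Rightarrow>\<^sub>L 'a) \<Rightarrow> bool" where
  "selfadj T \<longleftrightarrow> (\<forall>x y. inner (T x) y = inner x (T y))"

definition pos_op :: "('a::real_inner \<Rightarrow>\<^sub>L 'a) \<Rightarrow> bool" where
  "pos_op T \<longleftrightarrow> selfadj T \<and> (\<forall>x. 0 \<le> inner (T x) x)"

definition op_le :: "('a::real_inner \<Rightarrow>\<^sub>L 'a) \<Rightarrow> ('a \<Rightarrow>\<^sub>L 'a) \<Rightarrow> bool" where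
  "op_le A B \<longleftrightarrow> pos_op (B - A)"

definition op_invertible :: "('a::real_normed_vector \<Rightarrow>\<^sub>L 'a) \<Rightarrow> bool" where
  "op_invertible T \<longleftrightarrow> (\<exists>S. S o\<^sub>L T = id_blinfun \<and> T o\<^sub>L S = id_blinfun)"

definition op_inv :: "('a::real_normed_vector \<Rightarrow>\<^sub>L 'a) \<Rightarrow> ('a \<Rightarrow>\<^sub>L 'a)" where
  "op_inv T = (THE S. S o\<^sub>L T = id_blinfun \<and> T o\<^sub>L S = id_blinfun)"

definition op_pow :: "('a::real_normed_vector \<Rightarrow>\<^sub>L 'a) \<Rightarrow> nat \<Rightarrow> ('a \<Rightarrow>\<^sub>L 'a)" where
  "op_pow T k = (((o\<^sub>L) T) ^^ k) id_blinfun"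

definition op_poly :: "real poly \<Rightarrow> ('a::real_normed_vector \<Rightarrow>\<^sub>L 'a) \<Rightarrow> ('a \<Rightarrow>\<^sub>L 'a)" where
  "op_poly p T = (\<Sum>k\<le>degree p. coeff p k *\<^sub>R op_pow T k)"

text \<open>lower and upper bounds of the numerical range; for self-adjoint T the spectrum lies in
  [num_lo T, num_hi T]\<close>
definition num_lo :: "('a::real_inner \<Rightarrow>\<^sub>L 'a) \<Rightarrow> real" where
  "num_lo T = Inf {inner (T x) x | x. norm x = 1}"

definition num_hi :: "('a::real_inner \<Rightarrow>\<^sub>L 'a) \<Rightarrow> real" where
  "num_hi T = Sup {inner (T x) x | x. norm x = 1}"

text \<open>continuous functional calculus for a self-adjoint operator: f(T) is the norm limit of
  p_k(T) for polynomials p_k converging uniformly to f on an interval containing the spectrum\<close>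
definition op_fc :: "(real \<Rightarrow> real) \<Rightarrow> ('a::{real_inner,complete_space} \<Rightarrow>\<^sub>L 'a) \<Rightarrow> ('a \<Rightarrow>\<^sub>L 'a)" where
  "op_fc f T = (THE X. \<forall>P :: nat \<Rightarrow> real poly.
      uniform_limit {num_lo T .. num_hi T} (\<lambda>k x. poly (P k) x) f sequentially
      \<longrightarrow> (\<lambda>k. op_poly (P k) T) \<longlonglongrightarrow> X)"

definition op_sqrt :: "('a::{real_inner,complete_space} \<Rightarrow>\<^sub>L 'a) \<Rightarrow> ('a \<Rightarrow>\<^sub>L 'a)" where
  "op_sqrt T = op_fc sqrt T"

definition persp :: "(real \<Rightarrow> real) \<Rightarrow> ('a::{real_inner,complete_space} \<Rightarrow>\<^sub>L 'a) \<Rightarrow> ('a \<Rightarrow>\<^sub>L 'a) \<Rightarrow> ('a \<Rightarrow>\<^sub>L 'a)" where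
  "persp f A B = op_sqrt B o\<^sub>L
      op_fc f (op_inv (op_sqrt B) o\<^sub>L A o\<^sub>L op_inv (op_sqrt B)) o\<^sub>L op_sqrt B"

definition supp_proj :: "('a::{real_inner,complete_space} \<Rightarrow>\<^sub>L 'a) \<Rightarrow> ('a \<Rightarrow>\<^sub>L 'a)" where
  "supp_proj B = (THE P. P o\<^sub>L P = P \<and> selfadj P \<and> range (blinfun_apply P) = closure (range (blinfun_apply B)))"

definition Dquot :: "('a::{real_inner,complete_space} \<Rightarrow>\<^sub>L 'a) \<Rightarrow> ('a \<Rightarrow>\<^sub>L 'a) \<Rightarrow> ('a \<Rightarrow>\<^sub>L 'a)" where
  "Dquot A B = (THE W. pos_op W \<and> W o\<^sub>L (id_blinfun - supp_proj B) = 0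
                      \<and> A = op_sqrt B o\<^sub>L W o\<^sub>L op_sqrt B)"

end

theory Submission
  imports Defs
begin

text \<open>
  Operator convexity enters through the continuity of \<open>f\<close> on \<open>[0,\<infinity>)\<close>. Let \<open>D = D(A/B)\<close>, let
  \<open>Q\<close> and \<open>S\<close> be the square roots of \<open>B\<close> and \<open>B + L\<^sub>n\<close>, and put \<open>V = S\<^sup>-\<^sup>1 Q\<close>, so that
  \<open>P\<^sub>f(A, B + L\<^sub>n) = S f(V D V\<^sup>*) S\<close>. Both \<open>V\<close> and \<open>V\<^sup>*\<close> are contractions. From
  \<open>V\<^sup>* S = Q\<close> and the strong convergence \<open>S \<rightarrow> Q\<close> one gets \<open>V\<^sup>* y \<rightarrow> y\<close> for \<open>y\<close> in the closure
  \<open>H\<close> of the range of \<open>B\<close>, and then \<open>V y \<rightarrow> y\<close> there because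
  \<open>\<parallel>V y - y\<parallel>\<^sup>2 \<le> 2 \<langle>y, y - V\<^sup>* y\<rangle>\<close>. Off \<open>H\<close> the operators \<open>V\<^sup>*\<close> need not converge strongly,
  but both \<open>D\<close> and \<open>Q\<close> map into \<open>H\<close>, so it is enough that \<open>(V D V\<^sup>*) y \<rightarrow> D y\<close> on \<open>H\<close>; this passes
  to polynomials and, by uniform approximation, to \<open>f\<close>.

  The functional calculus rests on the bound of \<open>\<parallel>p(T)\<parallel>\<close> by the maximum of \<open>|p|\<close> on the numerical
  range: with \<open>l = \<parallel>p(T)\<parallel>\<close>, the operator \<open>p(T)\<^sup>2 - l\<^sup>2\<close> is not bounded below, so some real linear
  factor \<open>T - r\<close> with \<open>p(r)\<^sup>2 = l\<^sup>2\<close> is not bounded below either. The projection \<open>s(B)\<close> and the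
  quotient \<open>D(A/B)\<close> are strong limits, as \<open>\<epsilon> \<rightarrow> 0\<close>, of \<open>B (B + \<epsilon>)\<^sup>-\<^sup>1\<close> and of \<open>R A R\<close>, where
  \<open>R\<close> is the inverse square root of \<open>B + \<epsilon>\<close>.
\<close>

subsection \<open>Operator polynomials of a self-adjoint operator\<close>

lemma op_pow_0: "op_pow T 0 = id_blinfun"
  and op_pow_Suc: "op_pow T (Suc k) = T o\<^sub>L op_pow T k"
  by (simp_all add: op_pow_def)

lemma op_poly_altdef:
  assumes "degree p \<le> n"
  shows "op_poly p T = (\<Sum>k\<le>n. coeff p k *\<^sub>R op_pow T k)"
  unfolding op_poly_def using assms
  by (intro sum.mono_neutral_left) (auto simp: coeff_eq_0)

lemma op_poly_pCons: "op_poly (pCons a p) T = a *\<^sub>R id_blinfun + (T o\<^sub>L op_poly p T)"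
proof -
  have "op_poly (pCons a p) T = (\<Sum>k\<le>Suc (degree p). coeff (pCons a p) k *\<^sub>R op_pow T k)"
    by (rule op_poly_altdef) (rule degree_pCons_le)
  also have "\<dots> = a *\<^sub>R id_blinfun + (\<Sum>k\<le>degree p. coeff p k *\<^sub>R (T o\<^sub>L op_pow T k))"
    by (simp add: sum.atMost_Suc_shift op_pow_0 op_pow_Suc del: sum.atMost_Suc)
  also have "(\<Sum>k\<le>degree p. coeff p k *\<^sub>R (T o\<^sub>L op_pow T k)) = T o\<^sub>L op_poly p T"
    unfolding op_poly_def by (rule blinfun_eqI) (simp add: blinfun.bilinear_simps blinfun.sum_left blinfun.sum_right)
  finally show ?thesis .
qed

lemma op_poly_0: "op_poly 0 T = 0"
  by (simp add: op_poly_def)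

lemma op_poly_add: "op_poly (p + q) T = op_poly p T + op_poly q T"
proof -
  let ?n = "max (degree p) (degree q)"
  have "degree (p + q) \<le> ?n" by (rule degree_add_le_max)
  then show ?thesis
    by (simp add: op_poly_altdef[of _ ?n] scaleR_add_left sum.distrib)
qed

lemma op_poly_smult: "op_poly (Polynomial.smult c p) T = c *\<^sub>R op_poly p T"
  by (simp add: op_poly_altdef[of _ "degree p"] degree_smult_le scaleR_sum_right)

lemma op_poly_diff: "op_poly (p - q) T = op_poly p T - op_poly q T"
  using op_poly_add[of "p - q" q T] by simp

lemma op_poly_mult: "op_poly (p * q) T = op_poly p T o\<^sub>L op_poly q T"
proof (induction p)
  case 0
  show ?case by (simp add: op_poly_0 blinfun_eqI)
next
  case (pCons a p)
  show ?case
    by (rule blinfun_eqI) (simp add: pCons.IH mult_pCons_left op_poly_add op_poly_smult op_poly_pCons blinfun.bilinear_simps)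
qed

lemma op_poly_X: "op_poly [:0, 1:] T = T"
  by (rule blinfun_eqI) (simp add: op_poly_pCons op_poly_0 blinfun.bilinear_simps)

lemma op_poly_const: "op_poly [:c:] T = c *\<^sub>R id_blinfun"
  by (rule blinfun_eqI) (simp add: op_poly_pCons op_poly_0 blinfun.bilinear_simps)

lemma selfadjD: "selfadj T \<Longrightarrow> inner (T x) y = inner x (T y)"
  by (simp add: selfadj_def)

lemma selfadj_id: "selfadj id_blinfun"
  and selfadj_scaleR: "selfadj T \<Longrightarrow> selfadj (c *\<^sub>R T)"
  and selfadj_add: "selfadj T \<Longrightarrow> selfadj S \<Longrightarrow> selfadj (T + S)"
  and selfadj_diff: "selfadj T \<Longrightarrow> selfadj S \<Longrightarrow> selfadj (T - S)"
  and selfadj_0: "selfadj 0"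
  by (simp_all add: selfadj_def blinfun.bilinear_simps inner_simps)

lemma selfadj_sandwich: "selfadj S \<Longrightarrow> selfadj T \<Longrightarrow> selfadj (S o\<^sub>L T o\<^sub>L S)"
  by (simp add: selfadj_def)

text \<open>By Horner's scheme it is enough that the product of \<open>T\<close> and
  \<open>op_poly p T\<close> is self-adjoint. It is, because the two commute: multiplication of
  polynomials is commutative.\<close>

lemma selfadj_op_poly:
  assumes "selfadj T"
  shows "selfadj (op_poly p T)"
proof (induction p)
  case 0
  show ?case by (simp add: op_poly_0 selfadj_0)
next
  case (pCons a p)
  have "T o\<^sub>L op_poly p T = op_poly p T o\<^sub>L T"
    using op_poly_mult[of "[:0,1:]" p T] op_poly_mult[of p "[:0,1:]" T] by (simp add: op_poly_X)
  then have "T (op_poly p T y) = op_poly p T (T y)" for y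
    by (metis blinfun_apply_blinfun_compose)
  then have "selfadj (T o\<^sub>L op_poly p T)"
    using assms pCons.IH by (simp add: selfadj_def)
  then show ?case
    by (simp add: op_poly_pCons selfadj_add selfadj_scaleR selfadj_id)
qed

section \<open>Operators bounded below\<close>

text \<open>For a self-adjoint operator on a Hilbert space this says that 0 is not in the spectrum.
  A norm bound expresses it without constructing an inverse.\<close>

definition bounded_away :: "('a::real_normed_vector \<Rightarrow>\<^sub>L 'a) \<Rightarrow> bool" where
  "bounded_away S \<longleftrightarrow> (\<exists>d>0. \<forall>x. d * norm x \<le> norm (S x))"

lemma bounded_away_compose:
  assumes "bounded_away S" "bounded_away T"
  shows "bounded_away (S o\<^sub>L T)"
proof -
  obtain d e where "d > 0" "\<And>x. d * norm x \<le> norm (S x)" "e > 0" "\<And>x. e * norm x \<le> norm (T x)"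
    using assms unfolding bounded_away_def by blast
  then have "d * (e * norm x) \<le> norm (S (T x))" for x
    by (meson less_imp_le mult_left_mono order_trans)
  then show ?thesis
    unfolding bounded_away_def using \<open>d > 0\<close> \<open>e > 0\<close>
    by (intro exI[of _ "d * e"]) (simp add: mult.assoc)
qed

text \<open>Cauchy-Schwarz turns a gap between 0 and the numerical range into a lower bound on the
  norm.\<close>

lemma bounded_away_numrange:
  fixes S :: "'a::real_inner \<Rightarrow>\<^sub>L 'a"
  assumes "d > 0" "\<And>x. d * (norm x)\<^sup>2 \<le> \<bar>inner (S x) x\<bar>"
  shows "bounded_away S"
  unfolding bounded_away_def
proof (intro exI conjI allI)
  fix x
  have "d * (norm x)\<^sup>2 \<le> norm (S x) * norm x"
    using assms(2)[of x] Cauchy_Schwarz_ineq2[of "S x" x] by linarith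
  then show "d * norm x \<le> norm (S x)"
    by (cases "x = 0") (auto simp: power2_eq_square)
qed (rule assms)

text \<open>The fundamental theorem of algebra gives a complex root \<open>z\<close>. A real
  \<open>z\<close> splits off a linear factor; otherwise the quadratic with roots \<open>z\<close>
  and its conjugate divides \<open>q\<close>, since the remainder is real, of degree at most 1, and
  vanishes at a nonreal point.\<close>

lemma real_poly_factor:
  fixes q :: "real poly"
  assumes "degree q > 0"
  obtains r where "[:- r, 1:] dvd q"
  | a b where "b \<noteq> 0" "[:a\<^sup>2 + b\<^sup>2, - 2 * a, 1:] dvd q"
proof -
  have add: "map_poly complex_of_real (p + q) = map_poly complex_of_real p + map_poly complex_of_real q"
    for p q by (rule poly_eqI) (simp add: coeff_map_poly)
  have pC: "map_poly complex_of_real (pCons u p) = pCons (of_real u) (map_poly complex_of_real p)" for u p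
    by (rule poly_eqI) (simp add: coeff_map_poly coeff_pCons split: nat.split)
  have "degree (map_poly complex_of_real q) > 0"
    using assms by (simp add: degree_map_poly)
  then obtain z where z: "poly (map_poly complex_of_real q) z = 0"
    using fundamental_theorem_of_algebra[of "map_poly complex_of_real q"] by (auto simp: constant_degree)
  have key: "poly (map_poly complex_of_real (p * s)) z = poly (map_poly complex_of_real p) z * poly (map_poly complex_of_real s) z"
    for p s
  proof (induction p)
    case (pCons a p)
    have "map_poly complex_of_real (Polynomial.smult a s) = Polynomial.smult (of_real a) (map_poly complex_of_real s)"
      by (rule poly_eqI) (simp add: coeff_map_poly)
    then show ?case using pCons
      by (simp add: mult_pCons_left pC add algebra_simps)
  qed auto
  define a b where "a = Re z" and "b = Im z"
  have zab: "z = Complex a b" by (simp add: a_def b_def)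
  show thesis
  proof (cases "b = 0")
    case True
    then have "z = of_real a" by (simp add: zab complex_eq_iff)
    moreover have "poly (map_poly complex_of_real q) (of_real a) = of_real (poly q a)"
      by (induction q) (auto simp: pC)
    ultimately have "poly q a = 0" using z by simp
    then show ?thesis using that(1) by (simp add: poly_eq_0_iff_dvd)
  next
    case False
    define s where "s = [:a\<^sup>2 + b\<^sup>2, - 2 * a, 1:]"
    have s0: "poly (map_poly complex_of_real s) z = 0"
      by (simp add: s_def pC zab complex_eq_iff power2_eq_square algebra_simps)
    have "degree (q mod s) < 2"
      using degree_mod_less[of s q] by (auto simp: s_def)
    then have "degree (q mod s) \<le> 1" by simp
    then obtain u v where uv: "q mod s = [:u, v:]"
      by (metis degree_eq_zeroE degree_pCons_eq_if le_SucE le_zero_eq One_nat_def pCons_cases pCons_0_0 nat.inject)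
    have "poly (map_poly complex_of_real q) z
        = poly (map_poly complex_of_real (q div s * s)) z + poly (map_poly complex_of_real (q mod s)) z"
      by (metis add div_mult_mod_eq poly_add)
    then have "poly (map_poly complex_of_real (q mod s)) z = 0"
      using z by (simp add: key s0)
    then have "of_real u + z * of_real v = 0"
      by (simp add: uv pC)
    then have "v = 0 \<and> u = 0"
      using False by (auto simp: zab complex_eq_iff)
    then have "s dvd q"
      using uv by (simp add: dvd_eq_mod_eq_0)
    then show ?thesis using False that(2) by (simp add: s_def)
  qed
qed

text \<open>A product of operators bounded below is bounded below, so some real irreducible factor
  of \<open>q\<close> yields an operator that is not. It cannot be a nonzero constant or a quadratic
  without real roots, and induction on the degree leaves a linear factor.\<close>

lemma not_bounded_away_root:
  fixes T :: "'a::real_inner \<Rightarrow>\<^sub>L 'a"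
  assumes "selfadj T" "q \<noteq> 0" "\<not> bounded_away (op_poly q T)"
  shows "\<exists>r. poly q r = 0 \<and> \<not> bounded_away (op_poly [:- r, 1:] T)"
  using assms(2,3)
proof (induction "degree q" arbitrary: q rule: less_induct)
  case less
  have "degree q > 0"
  proof (rule ccontr)
    assume "\<not> degree q > 0"
    then obtain c where c: "q = [:c:]" by (metis degree_eq_zeroE gr0I)
    with less.prems have "c \<noteq> 0" by simp
    then have "bounded_away (op_poly q T)"
      unfolding bounded_away_def
      by (intro exI[of _ "\<bar>c\<bar>"]) (simp add: c op_poly_const blinfun.bilinear_simps)
    with less.prems show False by simp
  qed
  then show ?case
  proof (cases rule: real_poly_factor)
    case (1 r)
    then obtain t where t: "q = [:- r, 1:] * t" by (elim dvdE)
    with less.prems have "t \<noteq> 0" by auto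
    then have deg: "degree t < degree q" by (simp only: t) (subst degree_mult_eq, auto)
    show ?thesis
    proof (cases "bounded_away (op_poly [:- r, 1:] T)")
      case False
      then show ?thesis using t by (intro exI[of _ r]) simp
    next
      case True
      then have "\<not> bounded_away (op_poly t T)"
        using less.prems bounded_away_compose[OF True] by (auto simp only: t op_poly_mult)
      from less.hyps[OF deg \<open>t \<noteq> 0\<close> this] show ?thesis by (auto simp: t)
    qed
  next
    case (2 a b)
    then obtain t where t: "q = [:a\<^sup>2 + b\<^sup>2, - 2 * a, 1:] * t" by (elim dvdE)
    with less.prems have "t \<noteq> 0" by auto
    then have deg: "degree t < degree q" by (simp only: t) (subst degree_mult_eq, auto)
    \<comment> \<open>The operator is \<open>(T - a)^2 + b^2\<close>, so its quadratic form is at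
      least \<open>b^2\<close> times the squared norm.\<close>
    have "bounded_away (op_poly [:a\<^sup>2 + b\<^sup>2, - 2 * a, 1:] T)"
    proof (rule bounded_away_numrange[of "b\<^sup>2"])
      fix x
      have "inner (op_poly [:a\<^sup>2 + b\<^sup>2, - 2 * a, 1:] T x) x = (norm (T x - a *\<^sub>R x))\<^sup>2 + b\<^sup>2 * (norm x)\<^sup>2"
        unfolding power2_norm_eq_inner
        by (simp add: op_poly_pCons op_poly_0 blinfun.bilinear_simps inner_simps selfadjD[OF assms(1), of "T x"]
            selfadjD[OF assms(1), of x "T x", symmetric] inner_commute[of x "T x"]
            power2_eq_square algebra_simps)
      then show "b\<^sup>2 * (norm x)\<^sup>2 \<le> \<bar>inner (op_poly [:a\<^sup>2 + b\<^sup>2, - 2 * a, 1:] T x) x\<bar>"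
        by simp
    qed (use 2 in simp)
    then have "\<not> bounded_away (op_poly t T)"
      using less.prems bounded_away_compose by (auto simp only: t op_poly_mult)
    from less.hyps[OF deg \<open>t \<noteq> 0\<close> this] show ?thesis
      by (metis t poly_mult mult_zero_right)
  qed
qed

section \<open>The norm bound for operator polynomials\<close>

text \<open>Explicit bounds \<open>a\<close> and \<open>b\<close> replace \<open>num_lo\<close> and
  \<open>num_hi\<close>: they make sense in the zero space too, and one interval can serve a whole
  family of operators.\<close>

definition numrange_in :: "('a::real_inner \<Rightarrow>\<^sub>L 'a) \<Rightarrow> real \<Rightarrow> real \<Rightarrow> bool" where
  "numrange_in T a b \<longleftrightarrow> selfadj T \<and>
     (\<forall>x. a * (norm x)\<^sup>2 \<le> inner (T x) x \<and> inner (T x) x \<le> b * (norm x)\<^sup>2)"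

lemma numrange_in_norm:
  assumes "selfadj T"
  shows "numrange_in T (- norm T) (norm T)"
proof -
  have "\<bar>inner (T x) x\<bar> \<le> norm T * (norm x)\<^sup>2" for x
  proof -
    have "\<bar>inner (T x) x\<bar> \<le> norm (T x) * norm x" by (rule Cauchy_Schwarz_ineq2)
    also have "\<dots> \<le> norm T * norm x * norm x" by (intro mult_right_mono norm_blinfun) auto
    finally show ?thesis by (simp add: power2_eq_square mult.assoc)
  qed
  then have "- norm T * (norm x)\<^sup>2 \<le> inner (T x) x \<and> inner (T x) x \<le> norm T * (norm x)\<^sup>2" for x
    by (metis abs_le_D1 abs_le_D2 minus_le_iff mult_minus_left)
  with assms show ?thesis by (simp add: numrange_in_def)
qed

text \<open>Covers the zero space, where the unit sphere is empty and \<open>num_lo\<close> and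
  \<open>num_hi\<close> carry no information.\<close>

lemma blinfun_eq_trivial:
  fixes S T :: "'a::real_normed_vector \<Rightarrow>\<^sub>L 'a"
  assumes "\<And>x::'a. x = 0"
  shows "S = T"
  by (rule blinfun_eqI) (metis assms)

lemma norm_op_poly_le:
  fixes T :: "'a::real_inner \<Rightarrow>\<^sub>L 'a"
  assumes T: "numrange_in T a b" and "0 \<le> e" and p: "\<And>r. r \<in> {a..b} \<Longrightarrow> \<bar>poly p r\<bar> \<le> e"
  shows "norm (op_poly p T) \<le> e"
proof (cases "\<exists>x::'a. x \<noteq> 0")
  case False
  then have "op_poly p T = 0" by (metis blinfun_eq_trivial)
  with assms show ?thesis by simp
next
  case True
  then obtain z :: 'a where z: "z \<noteq> 0" by blast
  have sa: "selfadj T" using T by (simp add: numrange_in_def)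
  have "a * (norm z)\<^sup>2 \<le> b * (norm z)\<^sup>2"
    using T unfolding numrange_in_def by (meson order_trans)
  with z have "a \<le> b" by simp
  define S where "S = op_poly p T"
  define l where "l = norm S"
  have saS: "selfadj S" unfolding S_def by (rule selfadj_op_poly[OF sa])
  \<comment> \<open>The real zeros of \<open>q\<close> are the points where the absolute value of
    \<open>p\<close> is \<open>l\<close>, so one zero in \<open>{a..b}\<close> proves the
    bound.\<close>
  define q where "q = p * p - [:l\<^sup>2:]"
  have q: "op_poly q T x = S (S x) - l\<^sup>2 *\<^sub>R x" for x
    by (simp add: q_def op_poly_diff op_poly_mult op_poly_const S_def blinfun.bilinear_simps)
  have nb: "\<not> bounded_away (op_poly q T)"
  proof
    assume "bounded_away (op_poly q T)"
    then obtain d where d: "d > 0" "\<And>x. d * norm x \<le> norm (S (S x) - l\<^sup>2 *\<^sub>R x)"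
      unfolding bounded_away_def q by blast
    \<comment> \<open>The square is expanded by self-adjointness of \<open>S\<close>, and
      \<open>norm (S (S x))\<close> is bounded by \<open>l * norm (S x)\<close>.\<close>
    have main: "d\<^sup>2 * (norm x)\<^sup>2 \<le> l\<^sup>2 * (l\<^sup>2 * (norm x)\<^sup>2 - (norm (S x))\<^sup>2)" for x
    proof -
      have "(d * norm x)\<^sup>2 \<le> (norm (S (S x) - l\<^sup>2 *\<^sub>R x))\<^sup>2"
        using d by (intro power_mono) auto
      also have "\<dots> = (norm (S (S x)))\<^sup>2 - 2 * l\<^sup>2 * (norm (S x))\<^sup>2 + l\<^sup>2 * l\<^sup>2 * (norm x)\<^sup>2"
        unfolding power2_norm_eq_inner
        by (simp add: inner_simps selfadjD[OF saS, of "S x"] selfadjD[OF saS, of x "S x", symmetric] algebra_simps)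
      also have "\<dots> \<le> (l * norm (S x))\<^sup>2 - 2 * l\<^sup>2 * (norm (S x))\<^sup>2 + l\<^sup>2 * l\<^sup>2 * (norm x)\<^sup>2"
        using norm_blinfun[of S "S x"] by (simp add: l_def power_mono)
      finally show ?thesis by (simp add: power_mult_distrib algebra_simps)
    qed
    have "d\<^sup>2 * (norm z)\<^sup>2 > 0" using d z by simp
    with main[of z] have "l \<noteq> 0" by auto
    then have l: "l > 0" by (simp add: l_def)
    \<comment> \<open>Solving \<open>main\<close> for the squared norm of \<open>S x\<close> bounds
      it by \<open>m\<close> times that of \<open>x\<close>. As \<open>m\<close> is strictly below
      \<open>l^2\<close>, the norm of \<open>S\<close> would be less than \<open>l\<close>.\<close>
    define m where "m = l\<^sup>2 - d\<^sup>2 / l\<^sup>2"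
    have Sm: "(norm (S x))\<^sup>2 \<le> m * (norm x)\<^sup>2" for x
      using main[of x] l by (simp add: m_def field_simps)
    have "0 \<le> m * (norm z)\<^sup>2" using Sm[of z] by (meson order_trans zero_le_power2)
    with z have m0: "m \<ge> 0" by (simp add: zero_le_mult_iff)
    have "norm (S x) \<le> sqrt m * norm x" for x
      using real_le_rsqrt[OF Sm[of x]] by (simp add: real_sqrt_mult)
    then have "l \<le> sqrt m" unfolding l_def by (intro norm_blinfun_bound) (auto simp: m0)
    then have "l\<^sup>2 \<le> m" using l m0 by (metis less_eq_real_def power_mono real_sqrt_pow2)
    moreover have "m < l\<^sup>2" using d l by (simp add: m_def)
    ultimately show False by simp
  qed
  \<comment> \<open>If \<open>q\<close> is zero, any point will do. Otherwise \<open>T - r\<close>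
    is not bounded below for some zero \<open>r\<close>; outside \<open>{a..b}\<close> its numerical
    range would keep a positive distance from 0.\<close>
  have "\<exists>r\<in>{a..b}. poly q r = 0"
  proof (cases "q = 0")
    case True
    then show ?thesis using \<open>a \<le> b\<close> by (intro bexI[of _ a]) auto
  next
    case False
    from not_bounded_away_root[OF sa False nb] obtain r where
      r: "poly q r = 0" "\<not> bounded_away (op_poly [:- r, 1:] T)" by blast
    have in_eq: "inner (op_poly [:- r, 1:] T x) x = inner (T x) x - r * (norm x)\<^sup>2" for x
      by (simp add: op_poly_pCons op_poly_0 blinfun.bilinear_simps inner_simps power2_norm_eq_inner)
    have "a \<le> r"
    proof (rule ccontr)
      assume "\<not> a \<le> r"
      moreover have "(a - r) * (norm x)\<^sup>2 \<le> \<bar>inner (op_poly [:- r, 1:] T x) x\<bar>" for x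
        unfolding in_eq using T by (auto simp: numrange_in_def left_diff_distrib intro: order_trans[OF _ abs_ge_self])
      ultimately show False using bounded_away_numrange[of "a - r"] r by auto
    qed
    moreover have "r \<le> b"
    proof (rule ccontr)
      assume "\<not> r \<le> b"
      moreover have "(r - b) * (norm x)\<^sup>2 \<le> \<bar>inner (op_poly [:- r, 1:] T x) x\<bar>" for x
        unfolding in_eq using T by (auto simp: numrange_in_def left_diff_distrib intro: order_trans[OF _ abs_ge_minus_self])
      ultimately show False using bounded_away_numrange[of "r - b"] r by auto
    qed
    ultimately show ?thesis using r by auto
  qed
  then obtain r where "r \<in> {a..b}" "poly q r = 0" by blast
  then have "(poly p r)\<^sup>2 = l\<^sup>2" by (simp add: q_def power2_eq_square)
  then have "l = \<bar>poly p r\<bar>" by (metis l_def norm_ge_zero abs_of_nonneg power2_eq_iff_nonneg power2_abs abs_ge_zero)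
  with p \<open>r \<in> {a..b}\<close> show ?thesis by (simp add: l_def S_def)
qed

subsection \<open>Functional calculus\<close>

text \<open>The uniform bound makes the linear pointwise limit bounded. Both the support projection
  and the Douglas quotient are obtained in this way.\<close>

lemma strong_limit_blinfun:
  fixes X :: "nat \<Rightarrow> 'a::real_normed_vector \<Rightarrow>\<^sub>L 'b::real_normed_vector"
  assumes "\<And>x. convergent (\<lambda>n. X n x)" "\<And>n. norm (X n) \<le> M"
  obtains W where "\<And>x. (\<lambda>n. X n x) \<longlonglongrightarrow> blinfun_apply W x"
proof -
  define w where "w x = lim (\<lambda>n. X n x)" for x
  have w: "(\<lambda>n. X n x) \<longlonglongrightarrow> w x" for x
    using assms(1)[of x] by (simp add: w_def convergent_LIMSEQ_iff)
  have "bounded_linear w"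
  proof (rule bounded_linear_intro[where K = M])
    fix x y
    have "(\<lambda>n. X n (x + y)) \<longlonglongrightarrow> w x + w y"
      using tendsto_add[OF w w] by (simp add: blinfun.add_right)
    with w show "w (x + y) = w x + w y" by (rule LIMSEQ_unique)
  next
    fix r x
    have "(\<lambda>n. X n (r *\<^sub>R x)) \<longlonglongrightarrow> r *\<^sub>R w x"
      using tendsto_scaleR[OF tendsto_const w] by (simp add: blinfun.scaleR_right)
    with w show "w (r *\<^sub>R x) = r *\<^sub>R w x" by (rule LIMSEQ_unique)
  next
    fix x
    have "norm (X n x) \<le> norm x * M" for n
      using norm_blinfun[of "X n" x] assms(2)[of n] mult_right_mono[of "norm (X n)" M "norm x"]
      by (simp add: mult.commute)
    then show "norm (w x) \<le> norm x * M"
      by (intro tendsto_upperbound[OF tendsto_norm[OF w]]) auto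
  qed
  then have "(\<lambda>n. X n x) \<longlonglongrightarrow> Blinfun w x" for x
    using w by (simp add: bounded_linear_Blinfun_apply)
  then show thesis by (rule that)
qed

text \<open>The library has this for codomains of class \<open>banach\<close>, which the sort used here does not entail.\<close>
lemma Cauchy_convergent_blinfun:
  fixes X :: "nat \<Rightarrow> 'a::real_normed_vector \<Rightarrow>\<^sub>L 'b::{real_normed_vector, complete_space}"
  assumes "Cauchy X"
  shows "convergent X"
proof -
  obtain M where M: "\<And>n. norm (X n) \<le> M"
    using Cauchy_Bseq[OF assms] by (auto simp: Bseq_def)
  have conv: "convergent (\<lambda>n. X n x)" for x
  proof (rule Cauchy_convergent)
    have "bounded_linear (\<lambda>Y :: 'a \<Rightarrow>\<^sub>L 'b. blinfun_apply Y x)"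
      by (rule blinfun.bounded_linear_left)
    then show "Cauchy (\<lambda>n. X n x)" using assms by (rule bounded_linear.Cauchy)
  qed
  obtain W where W: "\<And>x. (\<lambda>n. X n x) \<longlonglongrightarrow> blinfun_apply W x"
    using strong_limit_blinfun[OF conv M] by blast
  have "X \<longlonglongrightarrow> W"
  proof (rule LIMSEQ_I)
    fix r :: real assume "r > 0"
    then obtain N where N: "\<And>m n. m \<ge> N \<Longrightarrow> n \<ge> N \<Longrightarrow> norm (X m - X n) < r / 2"
      using CauchyD[OF assms, of "r / 2"] by auto
    \<comment> \<open>The Cauchy estimate passes to the limit in \<open>m\<close> at each vector;
      \<open>r / 2\<close> leaves room for the final strict inequality.\<close>
    have "norm (X n - W) \<le> r / 2" if "n \<ge> N" for n
    proof (rule norm_blinfun_bound)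
      fix x
      have "(\<lambda>m. norm (X n x - X m x)) \<longlonglongrightarrow> norm (X n x - W x)"
        by (intro tendsto_intros W)
      moreover have "norm (X n x - X m x) \<le> r / 2 * norm x" if "m \<ge> N" for m
      proof -
        have "norm ((X n - X m) x) \<le> norm (X n - X m) * norm x" by (rule norm_blinfun)
        also have "\<dots> \<le> r / 2 * norm x"
          using N[OF \<open>n \<ge> N\<close> that] by (intro mult_right_mono) auto
        finally show ?thesis by (simp add: blinfun.diff_left)
      qed
      ultimately have "norm (X n x - W x) \<le> r / 2 * norm x"
        by (intro tendsto_upperbound[where F = sequentially and f = "\<lambda>m. norm (X n x - X m x)"])
          (auto simp: eventually_sequentially)
      then show "norm ((X n - W) x) \<le> r / 2 * norm x" by (simp add: blinfun.diff_left)
    qed (use \<open>r > 0\<close> in simp)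
    with \<open>r > 0\<close> show "\<exists>N. \<forall>n\<ge>N. norm (X n - W) < r" by (intro exI[of _ N]) fastforce
  qed
  then show ?thesis by (rule convergentI)
qed

section \<open>Polynomial approximation and well-definedness of the calculus\<close>

text \<open>Stone-Weierstrass: polynomial functions form an algebra with constants, and the identity
  separates points.\<close>

lemma real_poly_approx:
  fixes f :: "real \<Rightarrow> real"
  assumes "continuous_on {a..b} f" "e > 0"
  obtains p where "\<And>x. x \<in> {a..b} \<Longrightarrow> \<bar>f x - poly p x\<bar> < e"
proof -
  have "\<exists>g. (\<exists>p. g = poly p) \<and> (\<forall>x\<in>{a..b}. \<bar>f x - g x\<bar> < e)"
  proof (rule Stone_Weierstrass_HOL)
    show "\<exists>p. (\<lambda>x. c) = poly p" for c :: real by (intro exI[of _ "[:c:]"]) auto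
    show "\<exists>p. (\<lambda>x. f x + g x) = poly p" if "(\<exists>p. f = poly p) \<and> (\<exists>p. g = poly p)" for f g :: "real \<Rightarrow> real"
    proof -
      from that obtain p q where "f = poly p" "g = poly q" by blast
      then show ?thesis by (intro exI[of _ "p + q"]) auto
    qed
    show "\<exists>p. (\<lambda>x. f x * g x) = poly p" if "(\<exists>p. f = poly p) \<and> (\<exists>p. g = poly p)" for f g :: "real \<Rightarrow> real"
    proof -
      from that obtain p q where "f = poly p" "g = poly q" by blast
      then show ?thesis by (intro exI[of _ "p * q"]) auto
    qed
    show "\<exists>f. (\<exists>p. f = poly p) \<and> f x \<noteq> f y" if "x \<in> {a..b} \<and> y \<in> {a..b} \<and> x \<noteq> y" for x y :: real
      using that by (intro exI[of _ "poly [:0, 1:]"]) auto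
  qed (use assms in \<open>auto intro: continuous_intros\<close>)
  then show thesis using that by blast
qed

lemma real_poly_uniform_limit:
  fixes f :: "real \<Rightarrow> real"
  assumes "continuous_on {a..b} f"
  obtains P where "uniform_limit {a..b} (\<lambda>k. poly (P k)) f sequentially"
proof -
  have "\<exists>p. \<forall>x\<in>{a..b}. \<bar>f x - poly p x\<bar> < inverse (Suc k)" for k
    using real_poly_approx[OF assms, of "inverse (Suc k)"] by (metis inverse_positive_iff_positive of_nat_0_less_iff zero_less_Suc)
  then obtain P where P: "\<And>k x. x \<in> {a..b} \<Longrightarrow> \<bar>f x - poly (P k) x\<bar> < inverse (Suc k)"
    by metis
  have "uniform_limit {a..b} (\<lambda>k. poly (P k)) f sequentially"
  proof (rule uniform_limitI)
    fix e :: real assume "e > 0"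
    then have "\<forall>\<^sub>F k in sequentially. inverse (Suc k) < e"
      using LIMSEQ_inverse_real_of_nat by (auto simp: tendsto_iff)
    then show "\<forall>\<^sub>F k in sequentially. \<forall>x\<in>{a..b}. dist (poly (P k) x) (f x) < e"
    proof eventually_elim
      case (elim k)
      then show ?case using P[of _ k] by (force simp: dist_real_def abs_minus_commute)
    qed
  qed
  then show thesis by (rule that)
qed

text \<open>Normalizing \<open>x\<close> to \<open>sgn x\<close> compares the quadratic form with
  the set that defines \<open>num_lo\<close> and \<open>num_hi\<close>; a nonzero vector makes this
  set nonempty. The interval used by \<open>op_fc\<close> is thus the smallest admissible
  one.\<close>

lemma numrange_in_num_lo_hi:
  fixes T :: "'a::real_inner \<Rightarrow>\<^sub>L 'a"
  assumes T: "numrange_in T a b" and "\<exists>x::'a. x \<noteq> 0"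
  shows "a \<le> num_lo T" "num_hi T \<le> b" "numrange_in T (num_lo T) (num_hi T)"
proof -
  let ?S = "{inner (T x) x | x. norm x = 1}"
  obtain z :: 'a where "z \<noteq> 0" using assms by blast
  then have "norm (sgn z) = 1" by (simp add: norm_sgn)
  then have ne: "?S \<noteq> {}" by blast
  have S: "a \<le> s \<and> s \<le> b" if "s \<in> ?S" for s
  proof -
    from that obtain x where "s = inner (T x) x" "norm x = 1" by blast
    then show ?thesis using T unfolding numrange_in_def by (metis mult.right_neutral power_one)
  qed
  show "a \<le> num_lo T" unfolding num_lo_def using ne S by (intro cInf_greatest) auto
  show "num_hi T \<le> b" unfolding num_hi_def using ne S by (intro cSup_least) auto
  have bdd: "bdd_below ?S" "bdd_above ?S" using S by (meson bdd_belowI bdd_aboveI)+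
  have "num_lo T * (norm x)\<^sup>2 \<le> inner (T x) x \<and> inner (T x) x \<le> num_hi T * (norm x)\<^sup>2" for x
  proof (cases "x = 0")
    case False
    then have "inner (T (sgn x)) (sgn x) \<in> ?S" by (auto simp: norm_sgn)
    then have "num_lo T \<le> inner (T (sgn x)) (sgn x) \<and> inner (T (sgn x)) (sgn x) \<le> num_hi T"
      unfolding num_lo_def num_hi_def using bdd by (auto intro: cInf_lower cSup_upper)
    moreover have "inner (T (sgn x)) (sgn x) = inner (T x) x / (norm x)\<^sup>2"
      by (simp add: sgn_div_norm blinfun.scaleR_right power2_eq_square divide_inverse)
    ultimately show ?thesis using False by (simp add: field_simps)
  qed simp
  with T show "numrange_in T (num_lo T) (num_hi T)" by (simp add: numrange_in_def)
qed

lemma norm_op_poly_diff_le: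
  fixes T :: "'a::real_inner \<Rightarrow>\<^sub>L 'a"
  assumes "numrange_in T a b" "0 \<le> e" "\<And>x. x \<in> {a..b} \<Longrightarrow> \<bar>poly p x - poly q x\<bar> \<le> e"
  shows "norm (op_poly p T - op_poly q T) \<le> e"
  using norm_op_poly_le[of T a b e "p - q"] assms by (simp add: op_poly_diff)

text \<open>The definite description in \<open>op_fc\<close> has a value: by the norm bound,
  polynomials uniformly close on the interval give operators close in norm, so approximating
  sequences are Cauchy and share their limit. The interval \<open>{a..b}\<close> may be larger than
  the numerical range requires.\<close>

lemma op_fc_limit:
  fixes T :: "'a::{real_inner,complete_space} \<Rightarrow>\<^sub>L 'a"
  assumes T: "numrange_in T a b" and P: "uniform_limit {a..b} (\<lambda>k. poly (P k)) f sequentially"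
  shows "(\<lambda>k. op_poly (P k) T) \<longlonglongrightarrow> op_fc f T"
proof (cases "\<exists>x::'a. x \<noteq> 0")
  case False
  then have "op_poly (P k) T = op_fc f T" for k by (metis blinfun_eq_trivial)
  then show ?thesis by simp
next
  case True
  note lohi = numrange_in_num_lo_hi[OF T True]
  let ?I = "{num_lo T..num_hi T}"
  have P: "uniform_limit ?I (\<lambda>k. poly (P k)) f sequentially"
    using P by (rule uniform_limit_on_subset) (use lohi in auto)
  have small: "\<forall>\<^sub>F k in sequentially. \<forall>x\<in>?I. \<bar>poly (Q k) x - f x\<bar> < e"
    if "uniform_limit ?I (\<lambda>k. poly (Q k)) f sequentially" "e > 0" for Q :: "nat \<Rightarrow> real poly" and e
    using uniform_limitD[OF that] by (simp add: dist_real_def)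
  have "Cauchy (\<lambda>k. op_poly (P k) T)"
  proof (rule CauchyI)
    fix e :: real assume "e > 0"
    then obtain N where N: "\<And>k x. k \<ge> N \<Longrightarrow> x \<in> ?I \<Longrightarrow> \<bar>poly (P k) x - f x\<bar> < e / 4"
      using small[OF P, of "e / 4"] unfolding eventually_sequentially
      by (metis divide_pos_pos zero_less_numeral)
    have "norm (op_poly (P m) T - op_poly (P n) T) \<le> e / 2" if "m \<ge> N" "n \<ge> N" for m n
    proof (rule norm_op_poly_diff_le[OF lohi(3)])
      fix x assume "x \<in> ?I"
      then show "\<bar>poly (P m) x - poly (P n) x\<bar> \<le> e / 2" using N[OF that(1), of x] N[OF that(2), of x] by linarith
    qed (use \<open>e > 0\<close> in simp)
    then show "\<exists>M. \<forall>m\<ge>M. \<forall>n\<ge>M. norm (op_poly (P m) T - op_poly (P n) T) < e"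
      using \<open>e > 0\<close> by (intro exI[of _ N]) fastforce
  qed
  then obtain X where X: "(\<lambda>k. op_poly (P k) T) \<longlonglongrightarrow> X"
    using Cauchy_convergent_blinfun convergentD by blast
  have all: "(\<lambda>k. op_poly (Q k) T) \<longlonglongrightarrow> X"
    if Q: "uniform_limit ?I (\<lambda>k. poly (Q k)) f sequentially" for Q
  proof -
    have "(\<lambda>k. op_poly (Q k) T - op_poly (P k) T) \<longlonglongrightarrow> 0"
    proof (rule tendstoI)
      fix e :: real assume "e > 0"
      then have "e / 4 > 0" by simp
      from small[OF P this] small[OF Q this]
      show "\<forall>\<^sub>F k in sequentially. dist (op_poly (Q k) T - op_poly (P k) T) 0 < e"
      proof eventually_elim
        case (elim k)
        have "norm (op_poly (Q k) T - op_poly (P k) T) \<le> e / 2"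
        proof (rule norm_op_poly_diff_le[OF lohi(3)])
          fix x assume "x \<in> ?I"
          with elim have "\<bar>poly (P k) x - f x\<bar> < e / 4" "\<bar>poly (Q k) x - f x\<bar> < e / 4" by auto
          then show "\<bar>poly (Q k) x - poly (P k) x\<bar> \<le> e / 2" by linarith
        qed (use \<open>e > 0\<close> in simp)
        with \<open>e > 0\<close> show ?case by simp
      qed
    qed
    from tendsto_add[OF this X] show ?thesis by simp
  qed
  \<comment> \<open>Uniqueness uses that \<open>P\<close> is an approximating sequence; if there
    were none, the defining condition would hold vacuously.\<close>
  have "op_fc f T = X"
    unfolding op_fc_def
  proof (rule the_equality)
    fix Y assume "\<forall>P. uniform_limit ?I (\<lambda>k x. poly (P k) x) f sequentially \<longrightarrow> (\<lambda>k. op_poly (P k) T) \<longlonglongrightarrow> Y"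
    with P have "(\<lambda>k. op_poly (P k) T) \<longlonglongrightarrow> Y" by blast
    then show "Y = X" using X LIMSEQ_unique by blast
  qed (use all in blast)
  with X show ?thesis by simp
qed

text \<open>For large \<open>k\<close> the polynomial \<open>P k\<close> is within
  \<open>e + d\<close> of \<open>p\<close>, so the estimate for polynomials applies and survives the
  limit. The case \<open>e = 0\<close> gives agreement with \<open>op_poly\<close>, the case
  \<open>p = 0\<close> a norm bound.\<close>

lemma norm_op_fc_diff_poly_le:
  fixes T :: "'a::{real_inner,complete_space} \<Rightarrow>\<^sub>L 'a"
  assumes T: "numrange_in T a b" and f: "continuous_on {a..b} f" and "0 \<le> e"
    and le: "\<And>x. x \<in> {a..b} \<Longrightarrow> \<bar>f x - poly p x\<bar> \<le> e"
  shows "norm (op_fc f T - op_poly p T) \<le> e"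
proof (rule field_le_epsilon)
  fix d :: real assume "d > 0"
  obtain P where P: "uniform_limit {a..b} (\<lambda>k. poly (P k)) f sequentially"
    using real_poly_uniform_limit[OF f] .
  have lim: "(\<lambda>k. norm (op_poly (P k) T - op_poly p T)) \<longlonglongrightarrow> norm (op_fc f T - op_poly p T)"
    by (intro tendsto_intros op_fc_limit[OF T P])
  show "norm (op_fc f T - op_poly p T) \<le> e + d"
  proof (rule tendsto_upperbound[OF lim])
    from uniform_limitD[OF P \<open>d > 0\<close>]
    show "\<forall>\<^sub>F k in sequentially. norm (op_poly (P k) T - op_poly p T) \<le> e + d"
    proof eventually_elim
      case (elim k)
      show ?case
      proof (rule norm_op_poly_diff_le[OF T])
        fix x assume "x \<in> {a..b}"
        then show "\<bar>poly (P k) x - poly p x\<bar> \<le> e + d"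
          using elim le[of x] by (force simp: dist_real_def)
      qed (use assms \<open>d > 0\<close> in simp)
    qed
  qed simp
qed

lemma op_fc_eq_op_poly:
  fixes T :: "'a::{real_inner,complete_space} \<Rightarrow>\<^sub>L 'a"
  assumes "numrange_in T a b" "\<And>x. x \<in> {a..b} \<Longrightarrow> f x = poly p x"
  shows "op_fc f T = op_poly p T"
proof -
  have "continuous_on {a..b} f"
    using continuous_on_cong[of "{a..b}" "{a..b}" f "poly p"] assms(2) by (simp add: continuous_on_poly continuous_on_id)
  from norm_op_fc_diff_poly_le[OF assms(1) this, of 0 p] assms(2) show ?thesis by simp
qed

lemma norm_op_fc_le:
  fixes T :: "'a::{real_inner,complete_space} \<Rightarrow>\<^sub>L 'a"
  assumes "numrange_in T a b" "continuous_on {a..b} f" "0 \<le> e" "\<And>x. x \<in> {a..b} \<Longrightarrow> \<bar>f x\<bar> \<le> e"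
  shows "norm (op_fc f T) \<le> e"
  using norm_op_fc_diff_poly_le[of T a b f e 0] assms by (simp add: op_poly_0)

lemma op_fc_cong:
  fixes T :: "'a::{real_inner,complete_space} \<Rightarrow>\<^sub>L 'a"
  assumes T: "numrange_in T a b" and f: "continuous_on {a..b} f" and eq: "\<And>x. x \<in> {a..b} \<Longrightarrow> f x = g x"
  shows "op_fc f T = op_fc g T"
proof -
  obtain P where P: "uniform_limit {a..b} (\<lambda>k. poly (P k)) f sequentially"
    using real_poly_uniform_limit[OF f] .
  then have "uniform_limit {a..b} (\<lambda>k. poly (P k)) g sequentially"
    using eq by (subst (asm) uniform_limit_cong'[where i = g]) auto
  from op_fc_limit[OF T P] op_fc_limit[OF T this] show ?thesis by (rule LIMSEQ_unique)
qed

lemma op_fc_diff: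
  fixes T :: "'a::{real_inner,complete_space} \<Rightarrow>\<^sub>L 'a"
  assumes T: "numrange_in T a b" and f: "continuous_on {a..b} f" and g: "continuous_on {a..b} g"
  shows "op_fc (\<lambda>x. f x - g x) T = op_fc f T - op_fc g T"
proof -
  obtain P where P: "uniform_limit {a..b} (\<lambda>k. poly (P k)) f sequentially"
    using real_poly_uniform_limit[OF f] .
  obtain Q where Q: "uniform_limit {a..b} (\<lambda>k. poly (Q k)) g sequentially"
    using real_poly_uniform_limit[OF g] .
  have "uniform_limit {a..b} (\<lambda>k. poly (P k - Q k)) (\<lambda>x. f x - g x) sequentially"
  proof -
    have "(\<lambda>k. poly (P k - Q k)) = (\<lambda>k x. poly (P k) x - poly (Q k) x)" by (intro ext) simp
    then show ?thesis using uniform_limit_minus[OF P Q] by metis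
  qed
  from op_fc_limit[OF T this] have "(\<lambda>k. op_poly (P k) T - op_poly (Q k) T) \<longlonglongrightarrow> op_fc (\<lambda>x. f x - g x) T"
    by (simp add: op_poly_diff)
  moreover have "(\<lambda>k. op_poly (P k) T - op_poly (Q k) T) \<longlonglongrightarrow> op_fc f T - op_fc g T"
    by (intro tendsto_intros op_fc_limit[OF T P] op_fc_limit[OF T Q])
  ultimately show ?thesis by (rule LIMSEQ_unique)
qed

lemma op_fc_mult:
  fixes T :: "'a::{real_inner,complete_space} \<Rightarrow>\<^sub>L 'a"
  assumes T: "numrange_in T a b" and f: "continuous_on {a..b} f" and g: "continuous_on {a..b} g"
  shows "op_fc (\<lambda>x. f x * g x) T = op_fc f T o\<^sub>L op_fc g T"
proof -
  obtain P where P: "uniform_limit {a..b} (\<lambda>k. poly (P k)) f sequentially"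
    using real_poly_uniform_limit[OF f] .
  obtain Q where Q: "uniform_limit {a..b} (\<lambda>k. poly (Q k)) g sequentially"
    using real_poly_uniform_limit[OF g] .
  have "bounded (f ` {a..b})" "bounded (g ` {a..b})"
    using f g by (auto intro!: compact_imp_bounded compact_continuous_image)
  then have "uniform_limit {a..b} (\<lambda>k. poly (P k * Q k)) (\<lambda>x. f x * g x) sequentially"
  proof -
    assume "bounded (f ` {a..b})" "bounded (g ` {a..b})"
    moreover have "(\<lambda>k. poly (P k * Q k)) = (\<lambda>k x. poly (P k) x * poly (Q k) x)" by (intro ext) simp
    ultimately show ?thesis using uniform_lim_mult[OF P Q] by metis
  qed
  from op_fc_limit[OF T this] have "(\<lambda>k. op_poly (P k) T o\<^sub>L op_poly (Q k) T) \<longlonglongrightarrow> op_fc (\<lambda>x. f x * g x) T"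
    by (simp add: op_poly_mult)
  moreover have "(\<lambda>k. op_poly (P k) T o\<^sub>L op_poly (Q k) T) \<longlonglongrightarrow> (op_fc f T o\<^sub>L op_fc g T)"
    by (intro bounded_bilinear.tendsto[OF bounded_bilinear_blinfun_compose] op_fc_limit[OF T P] op_fc_limit[OF T Q])
  ultimately show ?thesis by (rule LIMSEQ_unique)
qed

lemma selfadj_strong_limit:
  fixes W :: "'a::real_inner \<Rightarrow>\<^sub>L 'a"
  assumes "F \<noteq> bot" "\<forall>\<^sub>F n in F. selfadj (X n)" "\<And>x. ((\<lambda>n. blinfun_apply (X n) x) \<longlongrightarrow> W x) F"
  shows "selfadj W"
  unfolding selfadj_def
proof (intro allI)
  fix x y
  have l: "((\<lambda>n. inner (X n x) y) \<longlongrightarrow> inner (W x) y) F" by (intro tendsto_inner tendsto_const assms)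
  have r: "((\<lambda>n. inner x (X n y)) \<longlongrightarrow> inner x (W y)) F" by (intro tendsto_inner tendsto_const assms)
  have "\<forall>\<^sub>F n in F. inner (X n x) y = inner x (X n y)"
    using assms(2) by eventually_elim (simp add: selfadj_def)
  from tendsto_cong[OF this] l have "((\<lambda>n. inner x (X n y)) \<longlongrightarrow> inner (W x) y) F" by blast
  from tendsto_unique[OF assms(1) this r] show "inner (W x) y = inner x (W y)" .
qed

lemma selfadj_op_fc:
  fixes T :: "'a::{real_inner,complete_space} \<Rightarrow>\<^sub>L 'a"
  assumes T: "numrange_in T a b" and f: "continuous_on {a..b} f"
  shows "selfadj (op_fc f T)"
proof -
  obtain P where P: "uniform_limit {a..b} (\<lambda>k. poly (P k)) f sequentially"
    using real_poly_uniform_limit[OF f] .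
  have "(\<lambda>k. op_poly (P k) T x) \<longlonglongrightarrow> op_fc f T x" for x
    by (intro blinfun.tendsto tendsto_intros op_fc_limit[OF T P])
  moreover have "selfadj (op_poly (P k) T)" for k
    using T by (simp add: numrange_in_def selfadj_op_poly)
  ultimately show ?thesis by (intro selfadj_strong_limit[of sequentially "\<lambda>k. op_poly (P k) T"]) auto
qed

text \<open>By multiplicativity \<open>op_fc f T\<close> is the square of the self-adjoint operator
  obtained from the square root of \<open>f\<close>, so its quadratic form is a squared
  norm.\<close>

lemma pos_op_op_fc:
  fixes T :: "'a::{real_inner,complete_space} \<Rightarrow>\<^sub>L 'a"
  assumes T: "numrange_in T a b" and f: "continuous_on {a..b} f" and pos: "\<And>x. x \<in> {a..b} \<Longrightarrow> 0 \<le> f x"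
  shows "pos_op (op_fc f T)"
proof -
  let ?S = "op_fc (\<lambda>x. sqrt (f x)) T"
  have sf: "continuous_on {a..b} (\<lambda>x. sqrt (f x))" by (intro continuous_intros f)
  have "op_fc f T = op_fc (\<lambda>x. sqrt (f x) * sqrt (f x)) T"
    using pos by (intro op_fc_cong[OF T f]) auto
  also have "\<dots> = ?S o\<^sub>L ?S" by (rule op_fc_mult[OF T sf sf])
  finally have eq: "op_fc f T = ?S o\<^sub>L ?S" .
  have "selfadj ?S" by (rule selfadj_op_fc[OF T sf])
  then have "inner (op_fc f T x) x = inner (?S x) (?S x)" for x
    by (simp add: eq selfadjD)
  then show ?thesis
    unfolding pos_op_def using selfadj_op_fc[OF T f] by simp
qed

section \<open>Strong convergence of the functional calculus\<close>

text \<open>Split \<open>X n (v n)\<close> into \<open>X n (v n - y)\<close>, controlled by the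
  uniform bound, and \<open>X n y\<close>. Convergence of the operators enters at the single vector
  \<open>y\<close> only.\<close>

lemma tendsto_blinfun_apply_bounded:
  fixes X :: "'b \<Rightarrow> 'a::real_normed_vector \<Rightarrow>\<^sub>L 'c::real_normed_vector"
  assumes bdd: "\<forall>\<^sub>F n in F. norm (X n) \<le> M"
    and X: "((\<lambda>n. X n y) \<longlongrightarrow> z) F" and v: "(v \<longlongrightarrow> y) F"
  shows "((\<lambda>n. X n (v n)) \<longlongrightarrow> z) F"
proof -
  have "((\<lambda>n. X n (v n - y)) \<longlongrightarrow> 0) F"
  proof (rule Lim_null_comparison)
    show "\<forall>\<^sub>F n in F. norm (X n (v n - y)) \<le> M * norm (v n - y)"
      using bdd by eventually_elim (meson norm_blinfun norm_ge_zero mult_right_mono order_trans)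
    have "((\<lambda>n. M * norm (v n - y)) \<longlongrightarrow> M * norm (y - y)) F"
      by (intro tendsto_intros v)
    then show "((\<lambda>n. M * norm (v n - y)) \<longlongrightarrow> 0) F" by simp
  qed
  from tendsto_add[OF this X] show ?thesis by (simp add: blinfun.diff_right)
qed

text \<open>Polynomials come first, then a three-epsilon argument by uniform approximation on the
  common interval. Convergence is assumed on \<open>H\<close> alone, and only \<open>D\<close> has
  to preserve \<open>H\<close>.\<close>

lemma op_fc_strong_limit:
  fixes D :: "'a::{real_inner,complete_space} \<Rightarrow>\<^sub>L 'a"
  assumes D: "numrange_in D a b" and f: "continuous_on {a..b} f"
    and T: "\<forall>\<^sub>F n in F. numrange_in (T n) a b"
    and inv: "\<And>y. y \<in> H \<Longrightarrow> blinfun_apply D y \<in> H"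
    and lim: "\<And>y. y \<in> H \<Longrightarrow> ((\<lambda>n. blinfun_apply (T n) y) \<longlongrightarrow> D y) F"
    and y: "y \<in> H"
  shows "((\<lambda>n. op_fc f (T n) y) \<longlongrightarrow> op_fc f D y) F"
proof -
  have polylim: "((\<lambda>n. op_poly p (T n) y) \<longlongrightarrow> op_poly p D y) F" if "y \<in> H" for p y
    using that
  proof (induction p arbitrary: y)
    case 0
    show ?case by (simp add: op_poly_0)
  next
    case (pCons c p)
    \<comment> \<open>Here \<open>S\<close> acts first, so that the induction hypothesis is used at
      \<open>D y\<close>, which lies in \<open>H\<close>; the vectors \<open>T n y\<close> need
      not.\<close>
    have eq: "op_poly (pCons c p) S y = c *\<^sub>R y + op_poly p S (S y)" for S :: "'a \<Rightarrow>\<^sub>L 'a"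
    proof -
      have "op_poly (pCons c p) S = op_poly ([:c:] + p * [:0, 1:]) S" by simp
      also have "\<dots> = c *\<^sub>R id_blinfun + (op_poly p S o\<^sub>L S)"
        by (simp only: op_poly_add op_poly_mult op_poly_X op_poly_const)
      finally show ?thesis by (simp add: blinfun.bilinear_simps)
    qed
    obtain M where M: "\<And>r. r \<in> {a..b} \<Longrightarrow> \<bar>poly p r\<bar> \<le> M"
    proof -
      have "bounded (poly p ` {a..b})"
        by (intro compact_imp_bounded compact_continuous_image continuous_on_poly continuous_on_id compact_Icc)
      then show thesis using that by (auto simp: bounded_iff) (metis atLeastAtMost_iff)
    qed
    have "\<forall>\<^sub>F n in F. norm (op_poly p (T n)) \<le> max 0 M"
      using T by eventually_elim (rule norm_op_poly_le, auto intro: order_trans[OF M])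
    from tendsto_blinfun_apply_bounded[OF this pCons.IH[OF inv[OF pCons.prems]] lim[OF pCons.prems]]
    show ?case
      unfolding eq by (rule tendsto_add[OF tendsto_const])
  qed
  show ?thesis
  proof (rule tendstoI)
    fix e :: real assume "e > 0"
    \<comment> \<open>The summand 1 keeps the denominator positive when
      \<open>y = 0\<close>.\<close>
    define d where "d = e / (3 * (norm y + 1))"
    have "norm y + 1 > 0" by (simp add: add_nonneg_pos)
    with \<open>e > 0\<close> have "d > 0" by (simp add: d_def)
    have "d * (norm y + 1) = e / 3"
      using \<open>norm y + 1 > 0\<close> nonzero_mult_divide_mult_cancel_right[of "norm y + 1" e 3]
      by (simp only: d_def times_divide_eq_left)
    with \<open>d > 0\<close> have "d * norm y < e / 3" by (simp add: distrib_left)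
    obtain p where p: "\<And>x. x \<in> {a..b} \<Longrightarrow> \<bar>f x - poly p x\<bar> < d"
      using real_poly_approx[OF f \<open>d > 0\<close>] by blast
    have close: "norm (op_fc f S y - op_poly p S y) < e / 3" if "numrange_in S a b" for S
    proof -
      have "norm (op_fc f S - op_poly p S) \<le> d"
        by (rule norm_op_fc_diff_poly_le[OF that f]) (use \<open>d > 0\<close> p in \<open>auto intro: less_imp_le\<close>)
      then have "norm ((op_fc f S - op_poly p S) y) \<le> d * norm y"
        by (meson norm_blinfun norm_ge_zero mult_right_mono order_trans)
      with \<open>d * norm y < e / 3\<close> show ?thesis by (simp add: blinfun.diff_left)
    qed
    have "\<forall>\<^sub>F n in F. dist (op_poly p (T n) y) (op_poly p D y) < e / 3"
      using polylim[OF y] \<open>e > 0\<close> by (intro tendstoD) auto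
    with T show "\<forall>\<^sub>F n in F. dist (op_fc f (T n) y) (op_fc f D y) < e"
    proof eventually_elim
      case (elim n)
      let ?u = "op_fc f (T n) y - op_poly p (T n) y" and ?v = "op_poly p (T n) y - op_poly p D y"
        and ?w = "op_fc f D y - op_poly p D y"
      have "norm (?u + ?v - ?w) < e"
        using close[OF elim(1)] close[OF D] elim(2) norm_triangle_ineq4[of "?u + ?v" ?w]
          norm_triangle_ineq[of ?u ?v]
        unfolding dist_norm by linarith
      then show ?case by (simp add: dist_norm)
    qed
  qed
qed

subsection \<open>Square roots and support projections\<close>

lemma norm_blinfun_le: "norm S \<le> K \<Longrightarrow> norm (blinfun_apply S x) \<le> K * norm x"
  by (rule order_trans[OF norm_blinfun mult_right_mono]) auto

lemma op_inv_eqI: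
  assumes "S o\<^sub>L T = id_blinfun" "T o\<^sub>L S = id_blinfun"
  shows "op_inv T = S"
  unfolding op_inv_def
proof (rule the_equality)
  fix R assume R: "R o\<^sub>L T = id_blinfun \<and> T o\<^sub>L R = id_blinfun"
  have "R x = S x" for x
  proof -
    have "R x = R (T (S x))" using assms(2) by (metis blinfun_apply_blinfun_compose blinfun_apply_id_blinfun id_apply)
    also have "\<dots> = S x" using R by (metis blinfun_apply_blinfun_compose blinfun_apply_id_blinfun id_apply)
    finally show ?thesis .
  qed
  then show "R = S" by (rule blinfun_eqI)
qed (use assms in simp)

lemma pos_op_selfadj: "pos_op T \<Longrightarrow> selfadj T"
  by (simp add: pos_op_def)

lemma numrange_in_mono:
  assumes "numrange_in T d (norm T)" "norm T \<le> b"
  shows "numrange_in T d b"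
  using assms unfolding numrange_in_def by (meson mult_right_mono order_trans zero_le_power2)

lemma numrange_in_pos_op:
  assumes "pos_op T" "norm T \<le> b"
  shows "numrange_in T 0 b"
proof -
  have "numrange_in T 0 (norm T)"
    using assms numrange_in_norm[of T] by (auto simp: numrange_in_def pos_op_def)
  then show ?thesis using assms(2) by (rule numrange_in_mono)
qed

lemma op_fc_id:
  fixes T :: "'a::{real_inner,complete_space} \<Rightarrow>\<^sub>L 'a"
  assumes "numrange_in T a b"
  shows "op_fc (\<lambda>x. x) T = T"
  using op_fc_eq_op_poly[OF assms, of "\<lambda>x. x" "[:0, 1:]"] by (simp add: op_poly_X)

lemma op_fc_1:
  fixes T :: "'a::{real_inner,complete_space} \<Rightarrow>\<^sub>L 'a"
  assumes "numrange_in T a b"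
  shows "op_fc (\<lambda>x. 1) T = id_blinfun"
  using op_fc_eq_op_poly[OF assms, of "\<lambda>x. 1" "[:1:]"] by (simp add: op_poly_const)

lemma op_fc_mult_apply:
  fixes T :: "'a::{real_inner,complete_space} \<Rightarrow>\<^sub>L 'a"
  assumes "numrange_in T a b" "continuous_on {a..b} f" "continuous_on {a..b} g"
    and "\<And>x. x \<in> {a..b} \<Longrightarrow> f x * g x = h x"
  shows "op_fc f T (op_fc g T x) = op_fc h T x"
proof -
  have "op_fc h T = op_fc (\<lambda>x. f x * g x) T"
    by (rule op_fc_cong[OF assms(1), symmetric]) (use assms in \<open>auto intro: continuous_intros\<close>)
  then show ?thesis using op_fc_mult[OF assms(1-3)] by simp
qed

lemma op_fc_mono:
  fixes T :: "'a::{real_inner,complete_space} \<Rightarrow>\<^sub>L 'a"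
  assumes "numrange_in T a b" "continuous_on {a..b} f" "continuous_on {a..b} g"
    and "\<And>x. x \<in> {a..b} \<Longrightarrow> f x \<le> g x"
  shows "inner (op_fc f T x) x \<le> inner (op_fc g T x) x"
proof -
  have "pos_op (op_fc (\<lambda>x. g x - f x) T)"
    by (rule pos_op_op_fc[OF assms(1)]) (use assms in \<open>auto intro: continuous_intros\<close>)
  then show ?thesis
    by (simp add: op_fc_diff[OF assms(1,3,2)] pos_op_def blinfun.diff_left inner_diff_left)
qed

lemma op_sqrt_props:
  fixes B :: "'a::{real_inner,complete_space} \<Rightarrow>\<^sub>L 'a"
  assumes "pos_op B"
  shows selfadj_op_sqrt: "selfadj (op_sqrt B)"
    and op_sqrt_op_sqrt: "op_sqrt B (op_sqrt B x) = B x"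
    and norm_op_sqrt_apply: "(norm (op_sqrt B x))\<^sup>2 = inner (B x) x"
proof -
  note B = numrange_in_pos_op[OF assms order_refl]
  have c: "continuous_on {0..norm B} sqrt" by (intro continuous_intros)
  show sa: "selfadj (op_sqrt B)" unfolding op_sqrt_def by (rule selfadj_op_fc[OF B c])
  show sq: "op_sqrt B (op_sqrt B x) = B x" for x
    unfolding op_sqrt_def using op_fc_mult_apply[OF B c c, of "\<lambda>x. x" x] by (simp add: op_fc_id[OF B])
  show "(norm (op_sqrt B x))\<^sup>2 = inner (B x) x"
    using selfadjD[OF sa, of "op_sqrt B x" x] by (simp add: sq power2_norm_eq_inner)
qed

text \<open>As \<open>d > 0\<close>, the function \<open>1 / sqrt x\<close> is continuous on
  \<open>{d..b}\<close>; by multiplicativity its operator is a two-sided inverse of the square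
  root.\<close>

lemma op_inv_op_sqrt:
  fixes C :: "'a::{real_inner,complete_space} \<Rightarrow>\<^sub>L 'a"
  assumes C: "numrange_in C d b" and "d > 0"
  shows selfadj_op_inv_op_sqrt: "selfadj (op_inv (op_sqrt C))"
    and op_inv_op_sqrt_left: "op_inv (op_sqrt C) (op_sqrt C x) = x"
    and op_inv_op_sqrt_right: "op_sqrt C (op_inv (op_sqrt C) x) = x"
proof -
  let ?R = "op_fc (\<lambda>x. 1 / sqrt x) C"
  have c: "continuous_on {d..b} sqrt" "continuous_on {d..b} (\<lambda>x. 1 / sqrt x)"
    using \<open>d > 0\<close> by (auto intro!: continuous_intros)
  have left: "?R (op_sqrt C x) = x" for x
    unfolding op_sqrt_def
    using op_fc_mult_apply[OF C c(2,1), of "\<lambda>x. 1" x] \<open>d > 0\<close> by (simp add: op_fc_1[OF C])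
  have right: "op_sqrt C (?R x) = x" for x
    unfolding op_sqrt_def
    using op_fc_mult_apply[OF C c, of "\<lambda>x. 1" x] \<open>d > 0\<close> by (simp add: op_fc_1[OF C])
  have R: "op_inv (op_sqrt C) = ?R"
    by (rule op_inv_eqI) (auto intro!: blinfun_eqI simp: left right)
  show "op_inv (op_sqrt C) (op_sqrt C x) = x" "op_sqrt C (op_inv (op_sqrt C) x) = x"
    by (simp_all add: R left right)
  show "selfadj (op_inv (op_sqrt C))" unfolding R by (rule selfadj_op_fc[OF C c(2)])
qed

text \<open>If \<open>S\<close> inverts \<open>L\<close>, then \<open>x\<close> is \<open>S\<close>
  applied twice after the square root of \<open>L\<close>, so \<open>norm x\<close> is at most a
  constant times \<open>norm (op_sqrt L x)\<close>, whose square is the quadratic form.\<close>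

lemma pos_op_invertible_coercive:
  fixes L :: "'a::{real_inner,complete_space} \<Rightarrow>\<^sub>L 'a"
  assumes "pos_op L" "op_invertible L"
  obtains d where "d > 0" "\<And>x. d * (norm x)\<^sup>2 \<le> inner (L x) x"
proof -
  obtain S where S: "S o\<^sub>L L = id_blinfun" using assms unfolding op_invertible_def by blast
  \<comment> \<open>The summand 1 makes \<open>K\<close> positive in the zero space too, where the
    norms vanish.\<close>
  define K where "K = norm S * norm (op_sqrt L) + 1"
  have "K > 0" by (simp add: K_def add_nonneg_pos)
  have "(inverse K)\<^sup>2 * (norm x)\<^sup>2 \<le> inner (L x) x" for x
  proof -
    have "x = S (op_sqrt L (op_sqrt L x))"
      using S by (metis assms(1) op_sqrt_op_sqrt blinfun_apply_blinfun_compose blinfun_apply_id_blinfun id_apply)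
    then have "norm x \<le> norm S * norm (op_sqrt L (op_sqrt L x))"
      using norm_blinfun[of S "op_sqrt L (op_sqrt L x)"] by simp
    also have "\<dots> \<le> norm S * (norm (op_sqrt L) * norm (op_sqrt L x))"
      by (intro mult_left_mono norm_blinfun norm_ge_zero)
    also have "\<dots> \<le> K * norm (op_sqrt L x)" by (simp add: K_def algebra_simps)
    finally have "inverse K * norm x \<le> norm (op_sqrt L x)" using \<open>K > 0\<close> by (simp add: field_simps)
    then have "(inverse K * norm x)\<^sup>2 \<le> (norm (op_sqrt L x))\<^sup>2" using \<open>K > 0\<close> by (intro power_mono) auto
    then show ?thesis by (simp add: norm_op_sqrt_apply[OF assms(1)] power_mult_distrib)
  qed
  with \<open>K > 0\<close> that[of "(inverse K)\<^sup>2"] show thesis by simp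
qed

text \<open>Monotone convergence: the squared norm of the difference of two terms is the quadratic
  form of \<open>(h m - h n)^2\<close>, at most that of \<open>k m - k n\<close>. The forms of
  \<open>k n\<close> increase and are bounded, hence Cauchy. The choices made later are
  \<open>k = h\<close>, for values increasing within \<open>[0,1]\<close>, and
  \<open>k = h^2\<close>.\<close>

lemma op_fc_convergent:
  fixes T :: "'a::{real_inner,complete_space} \<Rightarrow>\<^sub>L 'a"
  assumes T: "numrange_in T a b"
    and h: "\<And>n. continuous_on {a..b} (h n)" and k: "\<And>n. continuous_on {a..b} (k n)"
    and le: "\<And>m n t. n \<le> m \<Longrightarrow> t \<in> {a..b} \<Longrightarrow> (h m t - h n t)\<^sup>2 \<le> k m t - k n t"
    and bdd: "\<And>n. inner (op_fc (k n) T x) x \<le> K"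
  shows "convergent (\<lambda>n::nat. op_fc (h n) T x)"
proof -
  define q where "q n = inner (op_fc (k n) T x) x" for n
  have diff: "(norm (op_fc (h m) T x - op_fc (h n) T x))\<^sup>2 \<le> q m - q n" if "n \<le> m" for m n
  proof -
    let ?g = "\<lambda>t. h m t - h n t"
    have g: "continuous_on {a..b} ?g" by (intro continuous_intros h)
    have "(norm (op_fc (h m) T x - op_fc (h n) T x))\<^sup>2 = inner (op_fc ?g T x) (op_fc ?g T x)"
      by (simp add: op_fc_diff[OF T h h] blinfun.diff_left power2_norm_eq_inner)
    also have "\<dots> = inner (op_fc (\<lambda>t. (?g t)\<^sup>2) T x) x"
      using selfadjD[OF selfadj_op_fc[OF T g], of "op_fc ?g T x" x] op_fc_mult_apply[OF T g g, of "\<lambda>t. (?g t)\<^sup>2" x]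
      by (simp add: power2_eq_square)
    also have "\<dots> \<le> inner (op_fc (\<lambda>t. k m t - k n t) T x) x"
      by (rule op_fc_mono[OF T]) (use that in \<open>auto intro!: continuous_intros h k le\<close>)
    also have "\<dots> = q m - q n"
      by (simp add: op_fc_diff[OF T k k] blinfun.diff_left inner_diff_left q_def)
    finally show ?thesis .
  qed
  have "incseq q"
  proof (rule incseq_SucI)
    fix n show "q n \<le> q (Suc n)" using diff[of n "Suc n"] order_trans[OF zero_le_power2] by fastforce
  qed
  moreover have "bdd_above (range q)" using bdd by (auto simp: q_def intro!: bdd_aboveI[of _ K])
  ultimately have "Cauchy q" by (meson LIMSEQ_imp_Cauchy LIMSEQ_incseq_SUP)
  have "Cauchy (\<lambda>n. op_fc (h n) T x)"
  proof (rule CauchyI')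
    fix e :: real assume "e > 0"
    then obtain N where N: "\<And>m n. m \<ge> N \<Longrightarrow> n \<ge> N \<Longrightarrow> norm (q m - q n) < e\<^sup>2"
      using CauchyD[OF \<open>Cauchy q\<close>, of "e\<^sup>2"] by auto
    have "dist (op_fc (h m) T x) (op_fc (h n) T x) < e" if "m \<ge> N" "m < n" for m n
    proof -
      have "(norm (op_fc (h n) T x - op_fc (h m) T x))\<^sup>2 < e\<^sup>2"
        using diff[of m n] N[of n m] that by auto
      then have "norm (op_fc (h n) T x - op_fc (h m) T x) < e"
        using \<open>e > 0\<close> by (simp add: power2_less_imp_less)
      then show ?thesis by (simp add: dist_norm norm_minus_commute)
    qed
    then show "\<exists>N. \<forall>m\<ge>N. \<forall>n>m. dist (op_fc (h m) T x) (op_fc (h n) T x) < e" by blast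
  qed
  then show ?thesis by (rule Cauchy_convergent)
qed

section \<open>The support projection\<close>

lemma closed_Collect_blinfun_eq: "closed {x. blinfun_apply S x = blinfun_apply T x}"
  by (intro closed_Collect_eq linear_continuous_on blinfun.bounded_linear_right)

lemma supp_proj_exists:
  fixes B :: "'a::{real_inner,complete_space} \<Rightarrow>\<^sub>L 'a"
  assumes "pos_op B"
  obtains P where "P o\<^sub>L P = P" "selfadj P" "range (blinfun_apply P) = closure (range (blinfun_apply B))"
proof -
  define b where "b = norm B"
  have B: "numrange_in B 0 b" unfolding b_def by (rule numrange_in_pos_op[OF assms order_refl])
  define e :: "nat \<Rightarrow> real" where "e n = inverse (Suc n)" for n
  have e: "e n > 0" for n by (simp add: e_def)
  have emono: "e m \<le> e n" if "n \<le> m" for m n using that by (simp add: e_def)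
  \<comment> \<open>The operator of \<open>g n\<close> is \<open>B\<close> times the inverse of
    \<open>B + e n\<close>; the functions increase to the indicator of the positive reals.\<close>
  define g where "g n t = t / (t + e n)" for n and t :: real
  have ne: "t + e n \<noteq> 0" if "0 \<le> t" for n t using e[of n] that by linarith
  have cg: "continuous_on {0..b} (g n)" for n
    unfolding g_def using ne by (intro continuous_intros) auto
  have ch: "continuous_on {0..b} (\<lambda>t. 1 / (t + e n))" for n
    using ne by (intro continuous_intros) auto
  have g01: "0 \<le> g n t \<and> g n t \<le> 1" if "0 \<le> t" for n t
    using e[of n] that by (simp add: g_def)
  have gmono: "g n t \<le> g m t" if "n \<le> m" "0 \<le> t" for m n t
    unfolding g_def using e[of m] emono[OF that(1)] that(2) by (intro divide_left_mono) auto
  have conv: "convergent (\<lambda>n. op_fc (g n) B x)" for x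
  proof (rule op_fc_convergent[OF B cg cg])
    fix m n :: nat and t assume "n \<le> m" "t \<in> {0..b}"
    \<comment> \<open>The increments lie in \<open>[0,1]\<close>, where squaring does not enlarge,
      so \<open>k = h = g\<close> is a valid choice.\<close>
    then have "0 \<le> g m t - g n t" "g m t - g n t \<le> 1"
      using gmono[of n m t] g01[of t m] g01[of t n] by auto
    then show "(g m t - g n t)\<^sup>2 \<le> g m t - g n t"
      using mult_left_le[of "g m t - g n t" "g m t - g n t"] by (simp add: power2_eq_square)
  next
    fix n
    have "inner (op_fc (g n) B x) x \<le> inner (op_fc (\<lambda>t. 1) B x) x"
      by (rule op_fc_mono[OF B cg]) (use g01 in auto)
    then show "inner (op_fc (g n) B x) x \<le> inner x x" by (simp add: op_fc_1[OF B])
  qed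
  have bdd: "norm (op_fc (g n) B) \<le> 1" for n
    by (rule norm_op_fc_le[OF B cg]) (use g01 in \<open>auto simp: abs_le_iff intro: order_trans[of _ 0]\<close>)
  obtain P where P: "\<And>x. (\<lambda>n. op_fc (g n) B x) \<longlonglongrightarrow> blinfun_apply P x"
    using strong_limit_blinfun[OF conv bdd] by blast
  have sa: "selfadj P"
    by (rule selfadj_strong_limit[OF _ _ P]) (simp_all add: selfadj_op_fc[OF B cg])
  \<comment> \<open>On the range of \<open>B\<close> the error comes from
    \<open>t - g n t * t = e n * g n t\<close>, which is at most \<open>e n\<close>.\<close>
  have PB: "P (B x) = B x" for x
  proof -
    have "(\<lambda>n. op_fc (g n) B (B x) - B x) \<longlonglongrightarrow> 0"
    proof (rule Lim_null_comparison[OF always_eventually], rule allI)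
      fix n
      have "norm (op_fc (\<lambda>t. g n t * t) B - op_poly [:0, 1:] B) \<le> e n"
      proof (rule norm_op_fc_diff_poly_le[OF B])
        fix t assume t: "t \<in> {0..b}"
        have "t - g n t * t = e n * g n t"
          using ne[of t n] t by (simp add: g_def field_simps)
        then show "\<bar>g n t * t - poly [:0, 1:] t\<bar> \<le> e n"
          using g01[of t n] t e[of n] by (simp add: abs_minus_commute mult_left_le)
      qed (use e[of n] in \<open>auto intro!: continuous_intros cg\<close>)
      then have "norm ((op_fc (\<lambda>t. g n t * t) B - B) x) \<le> e n * norm x"
        unfolding op_poly_X by (rule norm_blinfun_le)
      moreover have "op_fc (g n) B (op_fc (\<lambda>t. t) B x) = op_fc (\<lambda>t. g n t * t) B x"
        by (rule op_fc_mult_apply[OF B cg]) (auto intro: continuous_intros)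
      ultimately show "norm (op_fc (g n) B (B x) - B x) \<le> e n * norm x"
        by (simp add: op_fc_id[OF B] blinfun.diff_left)
      show "(\<lambda>n. e n * norm x) \<longlonglongrightarrow> 0"
        unfolding e_def by (rule tendsto_mult_left_zero[OF LIMSEQ_inverse_real_of_nat])
    qed
    then have "(\<lambda>n. op_fc (g n) B (B x)) \<longlonglongrightarrow> B x" by (simp add: LIM_zero_iff)
    with P show ?thesis by (rule LIMSEQ_unique)
  qed
  have fixp: "P y = y" if "y \<in> closure (range B)" for y
  proof -
    have "closed {x. P x = x}" using closed_Collect_blinfun_eq[of P id_blinfun] by simp
    then have "closure (range B) \<subseteq> {x. P x = x}"
      by (intro closure_minimal) (auto simp: PB)
    with that show ?thesis by auto
  qed
  \<comment> \<open>Every approximant factors as \<open>B\<close> after another operator, so its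
    values lie in the range of \<open>B\<close>.\<close>
  have ran: "P x \<in> closure (range B)" for x
  proof -
    have "op_fc (g n) B x = B (op_fc (\<lambda>t. 1 / (t + e n)) B x)" for n
      using op_fc_mult_apply[OF B continuous_on_id ch, of n "g n" x]
      by (simp add: op_fc_id[OF B] g_def)
    then have "op_fc (g n) B x \<in> range B" for n by simp
    with P[of x] show ?thesis
      unfolding closure_sequential by (intro exI[of _ "\<lambda>n. op_fc (g n) B x"]) simp
  qed
  show thesis
  proof (rule that[OF _ sa])
    show "P o\<^sub>L P = P" by (rule blinfun_eqI) (simp add: fixp ran)
    show "range P = closure (range B)" using fixp ran by (metis image_subsetI rangeI subsetI subset_antisym)
  qed
qed

text \<open>Two such projections fix each other's range, so \<open>P' P = P\<close> and
  \<open>P P' = P'\<close>; taking adjoints shows that they agree, and the definite description is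
  justified.\<close>

lemma supp_proj_props:
  fixes B :: "'a::{real_inner,complete_space} \<Rightarrow>\<^sub>L 'a"
  assumes "pos_op B"
  shows selfadj_supp_proj: "selfadj (supp_proj B)"
    and range_supp_proj: "range (blinfun_apply (supp_proj B)) = closure (range (blinfun_apply B))"
    and supp_proj_fix: "y \<in> closure (range (blinfun_apply B)) \<Longrightarrow> supp_proj B y = y"
proof -
  let ?Q = "\<lambda>P. P o\<^sub>L P = P \<and> selfadj P \<and> range (blinfun_apply P) = closure (range (blinfun_apply B))"
  have fixp: "P y = y" if "?Q P" "y \<in> closure (range (blinfun_apply B))" for P y
    using that by (metis blinfun_apply_blinfun_compose imageE)
  obtain P where "P o\<^sub>L P = P" "selfadj P" "range (blinfun_apply P) = closure (range (blinfun_apply B))"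
    by (rule supp_proj_exists[OF assms])
  then have P: "?Q P" by (intro conjI)
  have "supp_proj B = P"
    unfolding supp_proj_def
  proof (rule the_equality)
    show "?Q P" by (rule P)
    fix P' assume P': "?Q P'"
    have "P' x = P x" for x
    proof (rule vector_eq_ldot[THEN iffD1], intro allI)
      fix y
      have "inner y (P x) = inner y (P' (P x))" using fixp[OF P'] P by (metis rangeI)
      also have "\<dots> = inner (P (P' y)) x" using P P' by (metis selfadj_def)
      also have "\<dots> = inner (P' y) x" using fixp[OF P] P' by (metis rangeI)
      also have "\<dots> = inner y (P' x)" using P' by (metis selfadj_def)
      finally show "inner y (P' x) = inner y (P x)" by simp
    qed
    then show "P' = P" by (rule blinfun_eqI)
  qed
  with P fixp[OF P, of y] show "selfadj (supp_proj B)"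
    "range (blinfun_apply (supp_proj B)) = closure (range (blinfun_apply B))"
    "y \<in> closure (range (blinfun_apply B)) \<Longrightarrow> supp_proj B y = y" by auto
qed

text \<open>The adjoint of \<open>s B = B\<close> is \<open>B s = B\<close>, so \<open>B\<close>
  annihilates \<open>x - s x\<close>. So does its square root, by \<open>norm_op_sqrt_apply\<close>,
  and another adjoint gives the second identity.\<close>

lemma op_sqrt_supp_proj:
  fixes B :: "'a::{real_inner,complete_space} \<Rightarrow>\<^sub>L 'a"
  assumes "pos_op B"
  shows "op_sqrt B (supp_proj B x) = op_sqrt B x" "supp_proj B (op_sqrt B x) = op_sqrt B x"
proof -
  let ?s = "supp_proj B"
  note sa = selfadj_supp_proj[OF assms] pos_op_selfadj[OF assms]
  have fixp: "?s (B x) = B x" for x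
    by (rule supp_proj_fix[OF assms subsetD[OF closure_subset rangeI]])
  have Bs: "B (?s x) = B x" for x
  proof (rule vector_eq_ldot[THEN iffD1], intro allI)
    fix y show "inner y (B (?s x)) = inner y (B x)"
      using sa fixp by (metis selfadj_def)
  qed
  show Qs: "op_sqrt B (?s x) = op_sqrt B x" for x
  proof -
    have "(norm (op_sqrt B (x - ?s x)))\<^sup>2 = inner (B (x - ?s x)) (x - ?s x)"
      by (rule norm_op_sqrt_apply[OF assms])
    also have "B (x - ?s x) = 0" by (simp add: blinfun.diff_right Bs)
    finally show ?thesis by (simp add: blinfun.diff_right)
  qed
  show "?s (op_sqrt B x) = op_sqrt B x"
  proof (rule vector_eq_ldot[THEN iffD1], intro allI)
    fix y show "inner y (?s (op_sqrt B x)) = inner y (op_sqrt B x)"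
      using sa(1) selfadj_op_sqrt[OF assms] Qs by (metis selfadj_def)
  qed
qed

subsection \<open>The Douglas quotient\<close>

text \<open>Moving from \<open>y\<close> to a nearby \<open>z\<close> in \<open>H\<close> costs at
  most \<open>K * d = e / 3\<close>, where \<open>K\<close> bounds the norms of \<open>Z\<close>
  and, eventually, of \<open>X n\<close>.\<close>

lemma tendsto_blinfun_apply_closure:
  fixes X :: "'b \<Rightarrow> 'a::real_normed_vector \<Rightarrow>\<^sub>L 'c::real_normed_vector"
  assumes bdd: "\<forall>\<^sub>F n in F. norm (X n) \<le> M"
    and H: "\<And>y. y \<in> H \<Longrightarrow> ((\<lambda>n. blinfun_apply (X n) y) \<longlongrightarrow> blinfun_apply Z y) F"
    and y: "y \<in> closure H"
  shows "((\<lambda>n. X n y) \<longlongrightarrow> Z y) F"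
proof (rule tendstoI)
  fix e :: real assume "e > 0"
  define K where "K = \<bar>M\<bar> + norm Z + 1"
  have "K > 0" by (simp add: K_def add_nonneg_pos)
  define d where "d = e / (3 * K)"
  have "d > 0" using \<open>e > 0\<close> \<open>K > 0\<close> by (simp add: d_def)
  have Kd: "K * d = e / 3" using \<open>K > 0\<close> by (simp add: d_def)
  obtain z where z: "z \<in> H" "dist z y < d"
    using y \<open>d > 0\<close> unfolding closure_approachable by blast
  have small: "norm (S y - S z) \<le> e / 3" if "norm S \<le> K" for S :: "'a \<Rightarrow>\<^sub>L 'c"
  proof -
    have "norm (S (y - z)) \<le> K * norm (y - z)" by (rule norm_blinfun_le[OF that])
    also have "\<dots> \<le> K * d" using z \<open>K > 0\<close> by (simp add: dist_norm norm_minus_commute)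
    finally show ?thesis by (simp add: Kd blinfun.diff_right)
  qed
  have Z: "norm Z \<le> K" by (simp add: K_def)
  have "\<forall>\<^sub>F n in F. dist (X n z) (Z z) < e / 3"
    using H[OF z(1)] \<open>e > 0\<close> by (intro tendstoD) auto
  with bdd show "\<forall>\<^sub>F n in F. dist (X n y) (Z y) < e"
  proof eventually_elim
    case (elim n)
    have "norm (X n) \<le> K" using elim(1) norm_ge_zero[of Z] unfolding K_def by linarith
    from small[OF this] small[OF Z] elim(2)
      norm_triangle_ineq4[of "(X n y - X n z) + (X n z - Z z)" "Z y - Z z"]
      norm_triangle_ineq[of "X n y - X n z" "X n z - Z z"]
    have "norm ((X n y - X n z) + (X n z - Z z) - (Z y - Z z)) < e"
      unfolding dist_norm by linarith
    then show ?case by (simp add: dist_norm)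
  qed
qed

text \<open>The closure argument in Cauchy form, for use before a limit operator is
  available.\<close>

lemma convergent_blinfun_apply_closure:
  fixes X :: "nat \<Rightarrow> 'a::real_normed_vector \<Rightarrow>\<^sub>L 'c::{real_normed_vector, complete_space}"
  assumes bdd: "\<And>n. norm (X n) \<le> M"
    and H: "\<And>y. y \<in> H \<Longrightarrow> convergent (\<lambda>n. blinfun_apply (X n) y)"
    and y: "y \<in> closure H"
  shows "convergent (\<lambda>n. X n y)"
proof (rule Cauchy_convergent, rule metric_CauchyI)
  fix e :: real assume "e > 0"
  define K where "K = \<bar>M\<bar> + 1"
  have "K > 0" by (simp add: K_def add_nonneg_pos)
  define d where "d = e / (3 * K)"
  have "d > 0" using \<open>e > 0\<close> \<open>K > 0\<close> by (simp add: d_def)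
  have Kd: "K * d = e / 3" using \<open>K > 0\<close> by (simp add: d_def)
  obtain z where z: "z \<in> H" "dist z y < d"
    using y \<open>d > 0\<close> unfolding closure_approachable by blast
  have small: "dist (X n y) (X n z) \<le> e / 3" for n
  proof -
    have "norm (X n) \<le> K" using bdd[of n] by (simp add: K_def)
    then have "norm (X n (y - z)) \<le> K * norm (y - z)" by (rule norm_blinfun_le)
    also have "\<dots> \<le> K * d" using z \<open>K > 0\<close> by (simp add: dist_norm norm_minus_commute)
    finally show ?thesis by (simp add: Kd blinfun.diff_right dist_norm)
  qed
  have "Cauchy (\<lambda>n. X n z)" using H[OF z(1)] by (rule convergent_Cauchy)
  then obtain N where N: "\<And>m n. m \<ge> N \<Longrightarrow> n \<ge> N \<Longrightarrow> dist (X m z) (X n z) < e / 3"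
    using metric_CauchyD[of "\<lambda>n. X n z" "e / 3"] \<open>e > 0\<close> by auto
  have "dist (X m y) (X n y) < e" if "m \<ge> N" "n \<ge> N" for m n
    using N[OF that] small[of m] small[of n] dist_triangle[of "X m y" "X n y" "X m z"]
      dist_triangle[of "X m z" "X n y" "X n z"] dist_commute[of "X n z" "X n y"] by linarith
  then show "\<exists>N. \<forall>m\<ge>N. \<forall>n\<ge>N. dist (X m y) (X n y) < e" by blast
qed

text \<open>The difference \<open>E\<close> satisfies \<open>Q E Q = 0\<close> and
  \<open>E s = E\<close>, hence also \<open>s E = E\<close>. So \<open>E (Q x)\<close> lies in the
  closure of the range of \<open>B\<close> and is orthogonal to it, which makes it 0; then
  \<open>E\<close> vanishes on that closure and, by \<open>E s = E\<close>, everywhere.\<close>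

lemma Dquot_unique:
  fixes B :: "'a::{real_inner,complete_space} \<Rightarrow>\<^sub>L 'a"
  assumes B: "pos_op B" and W: "pos_op W" "W o\<^sub>L (id_blinfun - supp_proj B) = 0"
    and W': "pos_op W'" "W' o\<^sub>L (id_blinfun - supp_proj B) = 0"
    and eq: "op_sqrt B o\<^sub>L W o\<^sub>L op_sqrt B = op_sqrt B o\<^sub>L W' o\<^sub>L op_sqrt B"
  shows "W = W'"
proof -
  let ?s = "supp_proj B" and ?Q = "op_sqrt B"
  define E where "E = W - W'"
  have E: "selfadj E" unfolding E_def using W W' by (intro selfadj_diff pos_op_selfadj)
  have Es: "E (?s x) = E x" for x
  proof -
    have "(W o\<^sub>L (id_blinfun - ?s)) x = 0" "(W' o\<^sub>L (id_blinfun - ?s)) x = 0" using W W' by simp_all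
    then show ?thesis by (simp add: E_def blinfun.bilinear_simps)
  qed
  have QEQ: "?Q (E (?Q x)) = 0" for x
  proof -
    have "(?Q o\<^sub>L W o\<^sub>L ?Q) x = (?Q o\<^sub>L W' o\<^sub>L ?Q) x" by (simp only: eq)
    then show ?thesis by (simp add: E_def blinfun.bilinear_simps)
  qed
  have EQ: "E (?Q x) = 0" for x
  proof -
    have "?s (E (?Q x)) \<in> closure (range B)" using range_supp_proj[OF B] by auto
    have z: "inner (?Q y) (E (?Q x)) = 0" for y
      using selfadjD[OF selfadj_op_sqrt[OF B], of y "E (?Q x)"] QEQ by simp
    then have "inner (B y) (E (?Q x)) = 0" for y
      using op_sqrt_op_sqrt[OF B, of y] by metis
    moreover have "closed {u. inner u (E (?Q x)) = 0}" by (intro closed_Collect_eq continuous_intros)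
    ultimately have "closure (range B) \<subseteq> {u. inner u (E (?Q x)) = 0}"
      by (intro closure_minimal) auto
    with \<open>?s (E (?Q x)) \<in> closure (range B)\<close> have "inner (?s (E (?Q x))) (E (?Q x)) = 0" by blast
    moreover have "?s (E (?Q x)) = E (?Q x)"
    proof (rule vector_eq_ldot[THEN iffD1], intro allI)
      fix y show "inner y (?s (E (?Q x))) = inner y (E (?Q x))"
        using E selfadj_supp_proj[OF B] Es by (metis selfadj_def)
    qed
    ultimately show ?thesis by simp
  qed
  have "E x = 0" for x
  proof -
    have "E (B y) = 0" for y using EQ op_sqrt_op_sqrt[OF B, of y] by metis
    then have "closure (range B) \<subseteq> {u. E u = (0 :: 'a \<Rightarrow>\<^sub>L 'a) u}"
      by (intro closure_minimal closed_Collect_blinfun_eq) auto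
    moreover have "?s x \<in> closure (range B)" using range_supp_proj[OF B] by auto
    ultimately show ?thesis using Es[of x] by auto
  qed
  then show ?thesis by (intro blinfun_eqI) (simp add: E_def blinfun.diff_left)
qed

text \<open>For self-adjoint factors, \<open>T S\<close> is the adjoint of \<open>S T\<close> and
  obeys the same norm bound.\<close>

lemma norm_selfadj_swap:
  assumes "selfadj S" "selfadj T" "0 \<le> K" "\<And>x. norm (blinfun_apply S (blinfun_apply T x)) \<le> K * norm x"
  shows "norm (T (S x)) \<le> K * norm x"
proof -
  have "(norm (T (S x)))\<^sup>2 = inner x (S (T (T (S x))))"
    using assms(1,2) unfolding power2_norm_eq_inner by (metis selfadj_def)
  also have "\<dots> \<le> norm x * norm (S (T (T (S x))))" by (rule norm_cauchy_schwarz)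
  also have "\<dots> \<le> norm x * (K * norm (T (S x)))" by (intro mult_left_mono assms norm_ge_zero)
  finally show ?thesis
    using assms(3) by (cases "T (S x) = 0") (auto simp: power2_eq_square mult_ac)
qed

text \<open>\<open>W\<close> is the strong limit of \<open>T n\<close>, the product of
  \<open>R n E\<close> and \<open>E R n\<close>, where \<open>R n\<close> is the inverse square root
  of \<open>B + e n\<close> and \<open>E\<close> the square root of \<open>A\<close>. The two
  factors are adjoint to each other, but strong convergence does not pass to adjoints, so each is
  treated separately.\<close>

lemma Dquot_exists:
  fixes A B :: "'a::{real_inner,complete_space} \<Rightarrow>\<^sub>L 'a"
  assumes A: "pos_op A" and B: "pos_op B" and "0 \<le> c"
    and le: "\<And>x. inner (A x) x \<le> c * inner (B x) x"
  obtains W where "pos_op W" "W o\<^sub>L (id_blinfun - supp_proj B) = 0" "A = op_sqrt B o\<^sub>L W o\<^sub>L op_sqrt B"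
proof -
  define b where "b = norm B"
  have nB: "numrange_in B 0 b" unfolding b_def by (rule numrange_in_pos_op[OF B order_refl])
  define e :: "nat \<Rightarrow> real" where "e n = inverse (Suc n)" for n
  have e: "e n > 0" for n by (simp add: e_def)
  have emono: "e m \<le> e n" if "n \<le> m" for m n using that by (simp add: e_def)
  have e0: "e \<longlonglongrightarrow> 0" unfolding e_def by (rule LIMSEQ_inverse_real_of_nat)
  define h where "h n t = 1 / sqrt (t + e n)" for n and t :: real
  have pos: "t + e n > 0" if "0 \<le> t" for n t using e[of n] that by linarith
  have ne: "t + e n \<noteq> 0" if "0 \<le> t" for n t using pos[OF that, of n] by linarith
  have ch: "continuous_on {0..b} (h n)" for n
    unfolding h_def using ne by (intro continuous_intros) auto
  have cs: "continuous_on {0..b} (\<lambda>t. sqrt (t + e n))" for n by (intro continuous_intros)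
  have cq: "continuous_on {0..b} sqrt" by (intro continuous_intros)
  have hpos: "h n t > 0" if "0 \<le> t" for n t using pos[OF that, of n] by (simp add: h_def)
  have hmono: "h n t \<le> h m t" if "n \<le> m" "0 \<le> t" for m n t
    unfolding h_def using pos[OF that(2)] emono[OF that(1)] that(2)
    by (intro divide_left_mono mult_pos_pos) auto
  \<comment> \<open>Both are functions of \<open>B\<close> itself rather than of
    \<open>B + e n\<close>, so multiplicativity lets them commute with the square root of
    \<open>B\<close>.\<close>
  define R S where "R n = op_fc (h n) B" and "S n = op_fc (\<lambda>t. sqrt (t + e n)) B" for n
  let ?E = "op_sqrt A" and ?Q = "op_sqrt B" and ?s = "supp_proj B"
  have saR: "selfadj (R n)" for n unfolding R_def by (rule selfadj_op_fc[OF nB ch])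
  have saE: "selfadj ?E" by (rule selfadj_op_sqrt[OF A])
  have hs: "h n t * sqrt (t + e n) = 1" "sqrt (t + e n) * h n t = 1" if "0 \<le> t" for n t
    using pos[OF that, of n] by (simp_all add: h_def)
  have RS: "R n (S n x) = x" for n x
    using op_fc_mult_apply[OF nB ch cs, of n n "\<lambda>t. 1" x] hs by (simp add: R_def S_def op_fc_1[OF nB])
  have SR: "S n (R n x) = x" for n x
    using op_fc_mult_apply[OF nB cs ch, of n n "\<lambda>t. 1" x] hs by (simp add: R_def S_def op_fc_1[OF nB])
  have RQ: "R n (?Q x) = op_fc (\<lambda>t. h n t * sqrt t) B x" for n x
    unfolding R_def op_sqrt_def by (rule op_fc_mult_apply[OF nB ch cq]) (rule refl)
  have QR: "?Q (R n x) = op_fc (\<lambda>t. h n t * sqrt t) B x" for n x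
    unfolding R_def op_sqrt_def by (rule op_fc_mult_apply[OF nB cq ch]) (rule mult.commute)
  have cv: "continuous_on {0..b} (\<lambda>t. h n t * sqrt t)" for n by (intro continuous_intros ch)
  have v01: "0 \<le> h n t * sqrt t \<and> h n t * sqrt t \<le> 1" if "0 \<le> t" for n t
    using that e[of n] pos[OF that, of n] by (simp add: h_def divide_le_eq_1)
  have QR_le: "norm (?Q (R n x)) \<le> norm x" for n x
  proof -
    have "norm (op_fc (\<lambda>t. h n t * sqrt t) B) \<le> 1"
      by (rule norm_op_fc_le[OF nB cv]) (use v01 in auto)
    from norm_blinfun_le[OF this, of x] show ?thesis by (simp add: QR)
  qed
  \<comment> \<open>Here \<open>A \<le> c B\<close> enters: it bounds \<open>E R n\<close>, and by
    adjoints \<open>R n E\<close>, by \<open>sqrt c\<close> uniformly in \<open>n\<close>.\<close>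
  have EQ_le: "norm (?E x) \<le> sqrt c * norm (?Q x)" for x
  proof -
    have "(norm (?E x))\<^sup>2 \<le> c * (norm (?Q x))\<^sup>2"
      using le[of x] by (simp add: norm_op_sqrt_apply[OF A] norm_op_sqrt_apply[OF B])
    from real_le_rsqrt[OF this] show ?thesis by (simp add: real_sqrt_mult)
  qed
  have ER_le: "norm (?E (R n x)) \<le> sqrt c * norm x" for n x
    using EQ_le[of "R n x"] mult_left_mono[OF QR_le[of n x], of "sqrt c"] \<open>0 \<le> c\<close> by simp
  have RE_le: "norm (R n (?E x)) \<le> sqrt c * norm x" for n x
    by (rule norm_selfadj_swap[OF saE saR _ ER_le]) (use \<open>0 \<le> c\<close> in simp)
  have nER: "norm (?E o\<^sub>L R n) \<le> sqrt c" "norm (R n o\<^sub>L ?E) \<le> sqrt c" for n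
    using \<open>0 \<le> c\<close> by (auto intro!: norm_blinfun_bound ER_le RE_le)
  \<comment> \<open>Monotone convergence with \<open>k = h^2\<close>: its quadratic form at
    \<open>E x\<close> is the squared norm of \<open>R n (E x)\<close>, which is bounded
    uniformly.\<close>
  have "convergent (\<lambda>n. op_fc (h n) B (?E x))" for x
  proof (rule op_fc_convergent[OF nB ch])
    show "continuous_on {0..b} (\<lambda>t. (h n t)\<^sup>2)" for n by (intro continuous_intros ch)
    fix m n :: nat and t assume nm: "n \<le> m" "t \<in> {0..b}"
    have "(h m t - h n t)\<^sup>2 = (h m t - h n t) * (h m t - h n t)" by (simp add: power2_eq_square)
    also have "\<dots> \<le> (h m t - h n t) * (h m t + h n t)"
      using hmono[OF nm(1), of t] hpos[of t] nm(2) by (intro mult_left_mono) (auto simp: less_imp_le)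
    also have "\<dots> = (h m t)\<^sup>2 - (h n t)\<^sup>2" by (simp add: power2_eq_square algebra_simps)
    finally show "(h m t - h n t)\<^sup>2 \<le> (h m t)\<^sup>2 - (h n t)\<^sup>2" .
  next
    fix n
    have "inner (op_fc (\<lambda>t. (h n t)\<^sup>2) B (?E x)) (?E x) = inner (R n (R n (?E x))) (?E x)"
      unfolding R_def using op_fc_mult_apply[OF nB ch ch, of n n "\<lambda>t. (h n t)\<^sup>2" "?E x"]
      by (simp add: power2_eq_square)
    also have "\<dots> = (norm (R n (?E x)))\<^sup>2" by (simp add: selfadjD[OF saR] power2_norm_eq_inner)
    also have "\<dots> \<le> (sqrt c * norm x)\<^sup>2" by (intro power_mono RE_le) auto
    finally show "inner (op_fc (\<lambda>t. (h n t)\<^sup>2) B (?E x)) (?E x) \<le> (sqrt c * norm x)\<^sup>2" .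
  qed
  then have convRE: "convergent (\<lambda>n. (R n o\<^sub>L ?E) x)" for x by (simp add: R_def)
  have convRQ: "convergent (\<lambda>n. R n (?Q x))" for x
    unfolding RQ
  proof (rule op_fc_convergent[OF nB cv cv])
    fix m n :: nat and t assume nm: "n \<le> m" "t \<in> {0..b}"
    let ?d = "h m t * sqrt t - h n t * sqrt t"
    have "0 \<le> ?d" "?d \<le> 1"
      using nm hmono[OF nm(1), of t] v01[of t m] v01[of t n] by (auto intro: mult_right_mono)
    then show "?d\<^sup>2 \<le> ?d" using mult_left_le[of ?d ?d] by (simp add: power2_eq_square)
  next
    fix n
    have "inner (op_fc (\<lambda>t. h n t * sqrt t) B x) x \<le> inner (op_fc (\<lambda>t. 1) B x) x"
      by (rule op_fc_mono[OF nB cv]) (use v01 in auto)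
    then show "inner (op_fc (\<lambda>t. h n t * sqrt t) B x) x \<le> inner x x" by (simp add: op_fc_1[OF nB])
  qed
  \<comment> \<open>\<open>Q R n = R n Q\<close> annihilates \<open>x - s x\<close>, and
    \<open>E\<close> is dominated by \<open>Q\<close>.\<close>
  have ER_ker: "?E (R n (x - ?s x)) = 0" for n x
  proof -
    have "?Q (R n (x - ?s x)) = R n (?Q (x - ?s x))" by (simp only: RQ QR)
    also have "\<dots> = 0" by (simp add: blinfun.diff_right op_sqrt_supp_proj[OF B])
    finally show ?thesis using EQ_le[of "R n (x - ?s x)"] by simp
  qed
  \<comment> \<open>Only \<open>s x\<close> matters. On \<open>B u = Q (Q u)\<close> convergence
    follows from that of \<open>R n Q\<close>, and the uniform bound extends it to the closure of
    the range.\<close>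
  have convER: "convergent (\<lambda>n. (?E o\<^sub>L R n) x)" for x
  proof -
    have "convergent (\<lambda>n. (?E o\<^sub>L R n) (?s x))"
    proof (rule convergent_blinfun_apply_closure[where X = "\<lambda>n. ?E o\<^sub>L R n", OF nER(1)])
      show "?s x \<in> closure (range B)" using range_supp_proj[OF B] by auto
      fix y assume "y \<in> range B"
      then obtain u where "y = ?Q (?Q u)" using op_sqrt_op_sqrt[OF B] by (metis imageE)
      moreover obtain l where "(\<lambda>n. R n (?Q (?Q u))) \<longlonglongrightarrow> l" using convRQ by (metis convergentD)
      ultimately show "convergent (\<lambda>n. (?E o\<^sub>L R n) y)"
        by (auto intro!: convergentI[of _ "?E l"] blinfun.tendsto)
    qed
    moreover have "(?E o\<^sub>L R n) (?s x) = (?E o\<^sub>L R n) x" for n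
      using ER_ker[of n x] by (simp add: blinfun.diff_right)
    ultimately show ?thesis by simp
  qed
  define T where "T n = R n o\<^sub>L A o\<^sub>L R n" for n
  have T: "T n x = (R n o\<^sub>L ?E) ((?E o\<^sub>L R n) x)" for n x
    by (simp add: T_def op_sqrt_op_sqrt[OF A])
  have convT: "convergent (\<lambda>n. T n x)" for x
  proof -
    obtain y where y: "(\<lambda>n. (?E o\<^sub>L R n) x) \<longlonglongrightarrow> y" using convER by (metis convergentD)
    obtain z where z: "(\<lambda>n. (R n o\<^sub>L ?E) y) \<longlonglongrightarrow> z" using convRE by (metis convergentD)
    have "(\<lambda>n. (R n o\<^sub>L ?E) ((?E o\<^sub>L R n) x)) \<longlonglongrightarrow> z"
      by (rule tendsto_blinfun_apply_bounded[OF always_eventually z y]) (use nER(2) in blast)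
    then show ?thesis unfolding T by (rule convergentI)
  qed
  have nT: "norm (T n) \<le> c" for n
  proof (rule norm_blinfun_bound[OF \<open>0 \<le> c\<close>])
    fix x
    have "norm (T n x) \<le> sqrt c * norm ((?E o\<^sub>L R n) x)" unfolding T by (rule norm_blinfun_le[OF nER(2)])
    also have "\<dots> \<le> sqrt c * (sqrt c * norm x)" using \<open>0 \<le> c\<close> ER_le by (intro mult_left_mono) auto
    finally show "norm (T n x) \<le> c * norm x" using \<open>0 \<le> c\<close> by (simp flip: mult.assoc)
  qed
  obtain W where W: "\<And>x. (\<lambda>n. T n x) \<longlonglongrightarrow> blinfun_apply W x"
    using strong_limit_blinfun[OF convT nT] by blast
  have Tpos: "pos_op (T n)" for n
    using A selfadj_sandwich[OF saR[of n], of A] saR[of n]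
    by (simp add: pos_op_def T_def selfadjD[OF saR])
  have saW: "selfadj W"
    by (rule selfadj_strong_limit[OF _ _ W]) (use Tpos in \<open>simp_all add: pos_op_def\<close>)
  have "0 \<le> inner (W x) x" for x
  proof (rule tendsto_lowerbound)
    show "(\<lambda>n. inner (T n x) x) \<longlonglongrightarrow> inner (W x) x" by (intro tendsto_inner W tendsto_const)
  qed (use Tpos in \<open>simp_all add: pos_op_def\<close>)
  with saW have Wpos: "pos_op W" by (simp add: pos_op_def)
  have "W (x - ?s x) = 0" for x
    using W[of "x - ?s x"] by (simp add: T ER_ker LIMSEQ_const_iff)
  then have Ws: "W o\<^sub>L (id_blinfun - ?s) = 0" by (intro blinfun_eqI) (simp add: blinfun.diff_left)
  have S: "S \<longlonglongrightarrow> ?Q"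
  proof -
    have "(\<lambda>n. S n - ?Q) \<longlonglongrightarrow> 0"
    proof (rule Lim_null_comparison[OF always_eventually], rule allI)
      fix n
      have "norm (op_fc (\<lambda>t. sqrt (t + e n) - sqrt t) B) \<le> sqrt (e n)"
      proof (rule norm_op_fc_le[OF nB])
        fix t assume "t \<in> {0..b}"
        then show "\<bar>sqrt (t + e n) - sqrt t\<bar> \<le> sqrt (e n)"
          using sqrt_add_le_add_sqrt[of t "e n"] e[of n] by simp
      qed (use e[of n] in \<open>auto intro!: continuous_intros\<close>)
      then show "norm (S n - ?Q) \<le> sqrt (e n)"
        by (simp add: op_fc_diff[OF nB cs cq] S_def op_sqrt_def)
      show "(\<lambda>n. sqrt (e n)) \<longlonglongrightarrow> 0" using tendsto_real_sqrt[OF e0] by simp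
    qed
    then show ?thesis by (simp add: LIM_zero_iff)
  qed
  \<comment> \<open>\<open>S n T n S n\<close> equals \<open>A\<close> for every \<open>n\<close>,
    so the limit of these products is \<open>A\<close> as well.\<close>
  have "A x = ?Q (W (?Q x))" for x
  proof -
    have Sx: "(\<lambda>n. S n x) \<longlonglongrightarrow> ?Q x" by (intro blinfun.tendsto S tendsto_const)
    have "(\<lambda>n. T n (S n x)) \<longlonglongrightarrow> W (?Q x)"
      by (rule tendsto_blinfun_apply_bounded[OF always_eventually W Sx]) (use nT in blast)
    then have "(\<lambda>n. S n (T n (S n x))) \<longlonglongrightarrow> ?Q (W (?Q x))" by (rule blinfun.tendsto[OF S])
    then show ?thesis by (simp add: T_def RS SR LIMSEQ_const_iff)
  qed
  then have "A = ?Q o\<^sub>L W o\<^sub>L ?Q" by (intro blinfun_eqI) simp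
  with Wpos Ws show thesis by (rule that)
qed

lemma Dquot_props:
  fixes A B :: "'a::{real_inner,complete_space} \<Rightarrow>\<^sub>L 'a"
  assumes A: "pos_op A" and B: "pos_op B" and "0 \<le> c"
    and le: "\<And>x. inner (A x) x \<le> c * inner (B x) x"
  shows pos_op_Dquot: "pos_op (Dquot A B)"
    and Dquot_supp: "Dquot A B o\<^sub>L (id_blinfun - supp_proj B) = 0"
    and Dquot_eq: "A = op_sqrt B o\<^sub>L Dquot A B o\<^sub>L op_sqrt B"
proof -
  let ?P = "\<lambda>W. pos_op W \<and> W o\<^sub>L (id_blinfun - supp_proj B) = 0 \<and> A = op_sqrt B o\<^sub>L W o\<^sub>L op_sqrt B"
  obtain W where "pos_op W" "W o\<^sub>L (id_blinfun - supp_proj B) = 0" "A = op_sqrt B o\<^sub>L W o\<^sub>L op_sqrt B"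
    by (rule Dquot_exists[OF assms])
  then have W: "?P W" by (intro conjI)
  have "Dquot A B = W"
    unfolding Dquot_def
  proof (rule the_equality)
    show "?P W" by (rule W)
    fix W' assume W': "?P W'"
    have "op_sqrt B o\<^sub>L W' o\<^sub>L op_sqrt B = op_sqrt B o\<^sub>L W o\<^sub>L op_sqrt B"
      using W W' by (elim conjE) (rule trans[OF sym])
    with Dquot_unique[OF B, of W' W] conjunct1[OF W] conjunct1[OF conjunct2[OF W]]
      conjunct1[OF W'] conjunct1[OF conjunct2[OF W']]
    show "W' = W" by blast
  qed
  then have "?P (Dquot A B)" using W by (rule ssubst)
  note D = conjunct1[OF this] conjunct2[OF this]
  show "pos_op (Dquot A B)" by (rule D(1))
  show "Dquot A B o\<^sub>L (id_blinfun - supp_proj B) = 0" by (rule conjunct1[OF D(2)])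
  show "A = op_sqrt B o\<^sub>L Dquot A B o\<^sub>L op_sqrt B" by (rule conjunct2[OF D(2)])
qed

subsection \<open>Operator convex functions are continuous\<close>

text \<open>Scalars as matrices of size 1, where operator convexity becomes ordinary
  convexity.\<close>

definition mat1 :: "real \<Rightarrow> complex mat" where
  "mat1 a = mat 1 1 (\<lambda>_. complex_of_real a)"

lemma mat1_simps [simp]: "mat1 a \<in> carrier_mat 1 1" "dim_row (mat1 a) = 1" "dim_col (mat1 a) = 1"
  "mat1 a $$ (0, 0) = complex_of_real a"
  by (auto simp: mat1_def)

lemma mat1_eqI:
  assumes "X \<in> carrier_mat 1 1" "X $$ (0, 0) = complex_of_real a"
  shows "X = mat1 a"
  using assms by (intro eq_matI) auto

lemma mat1_mult_vec:
  assumes "v \<in> carrier_vec 1"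
  shows "mat1 a *\<^sub>v v = complex_of_real a \<cdot>\<^sub>v v"
  using assms by (intro eq_vecI) (auto simp: scalar_prod_def)

lemma mat_hermitian_mat1: "mat_hermitian (mat1 a)"
  unfolding mat_hermitian_def
  by (auto intro!: mat1_eqI simp: mat_adjoint_def mat_of_rows_def)

lemma Re_form_mat1:
  assumes "v \<in> carrier_vec 1"
  shows "Re ((mat1 a *\<^sub>v v) \<bullet>c v) = a * (cmod (v $ 0))\<^sup>2"
proof -
  have "(mat1 a *\<^sub>v v) \<bullet>c v = complex_of_real a * (v $ 0 * cnj (v $ 0))"
    using assms by (simp add: mat1_mult_vec scalar_prod_def mult.assoc)
  also have "v $ 0 * cnj (v $ 0) = complex_of_real ((cmod (v $ 0))\<^sup>2)"
    by (rule complex_norm_square[symmetric])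
  finally show ?thesis by (simp del: of_real_power)
qed

lemma mat_pd_mat1:
  assumes "a > 0"
  shows "mat_pd (mat1 a)"
proof -
  have "v $ 0 \<noteq> 0" if "v \<in> carrier_vec 1" "v \<noteq> 0\<^sub>v 1" for v :: "complex vec"
  proof
    assume "v $ 0 = 0"
    with that(1) have "v = 0\<^sub>v 1" by (intro eq_vecI) auto
    with that(2) show False by simp
  qed
  then show ?thesis
    using assms mat_hermitian_mat1 by (auto simp: mat_pd_def Re_form_mat1)
qed

lemma mat_psd_mat1_iff: "mat_psd (mat1 a) \<longleftrightarrow> 0 \<le> a"
proof
  assume "mat_psd (mat1 a)"
  then have "0 \<le> Re ((mat1 a *\<^sub>v vec 1 (\<lambda>_. 1)) \<bullet>c vec 1 (\<lambda>_. 1))"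
    by (simp add: mat_psd_def)
  then show "0 \<le> a" by (simp add: Re_form_mat1)
qed (simp add: mat_psd_def mat_hermitian_mat1 Re_form_mat1)

lemma eigenvalue_mat1_iff: "eigenvalue (mat1 a) k \<longleftrightarrow> k = complex_of_real a"
proof
  assume "eigenvalue (mat1 a) k"
  then obtain v where v: "v \<in> carrier_vec 1" "v \<noteq> 0\<^sub>v 1" "mat1 a *\<^sub>v v = k \<cdot>\<^sub>v v"
    by (auto simp: eigenvalue_def eigenvector_def)
  have "v $ 0 \<noteq> 0"
  proof
    assume "v $ 0 = 0"
    with v(1) have "v = 0\<^sub>v 1" by (intro eq_vecI) auto
    with v(2) show False by simp
  qed
  moreover have "(complex_of_real a \<cdot>\<^sub>v v) $ 0 = (k \<cdot>\<^sub>v v) $ 0"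
    using v by (simp add: mat1_mult_vec)
  ultimately show "k = complex_of_real a" using v(1) by simp
next
  assume k: "k = complex_of_real a"
  have "vec 1 (\<lambda>_. 1 :: complex) $ 0 \<noteq> 0\<^sub>v 1 $ 0" by simp
  then have "vec 1 (\<lambda>_. 1 :: complex) \<noteq> 0\<^sub>v 1" by metis
  then have "eigenvector (mat1 a) (vec 1 (\<lambda>_. 1)) k"
    by (simp add: eigenvector_def k mat1_mult_vec)
  then show "eigenvalue (mat1 a) k" by (auto simp: eigenvalue_def)
qed

lemma mat1_power: "mat1 a ^\<^sub>m k = mat1 (a ^ k)"
  by (induction k) (auto intro!: mat1_eqI simp: scalar_prod_def mult.commute)

lemma mat_poly_mat1: "mat_poly p (mat1 a) = mat 1 1 (\<lambda>_. poly p (complex_of_real a))"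
  by (rule eq_matI) (auto simp: mat_poly_def mat1_power poly_altdef)

text \<open>The only eigenvalue is \<open>a\<close>, so an admissible polynomial takes the value
  \<open>f a\<close> there; the constant polynomial \<open>f a\<close> gives uniqueness.\<close>

lemma mat_fc_mat1: "mat_fc f (mat1 a) = mat1 (f a)"
  unfolding mat_fc_def
proof (rule the_equality)
  show "\<forall>p. (\<forall>k. eigenvalue (mat1 a) k \<longrightarrow> poly p k = complex_of_real (f (Re k))) \<longrightarrow>
      mat_poly p (mat1 a) = mat1 (f a)"
    by (auto simp: eigenvalue_mat1_iff mat_poly_mat1 intro!: mat1_eqI)
next
  fix X
  assume "\<forall>p. (\<forall>k. eigenvalue (mat1 a) k \<longrightarrow> poly p k = complex_of_real (f (Re k))) \<longrightarrow>
      mat_poly p (mat1 a) = X"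
  then have "mat_poly [:complex_of_real (f a):] (mat1 a) = X" by (simp add: eigenvalue_mat1_iff)
  moreover have "mat_poly [:complex_of_real (f a):] (mat1 a) = mat1 (f a)"
    by (auto simp: mat_poly_mat1 intro!: mat1_eqI)
  ultimately show "X = mat1 (f a)" by simp
qed

lemma operator_convex_pos_imp_convex_on:
  assumes "operator_convex_pos f"
  shows "convex_on {0<..} f"
proof (rule convex_onI)
  fix t x y :: real
  assume t: "0 < t" "t < 1" and xy: "x \<in> {0<..}" "y \<in> {0<..}"
  let ?l = "\<lambda>u v. complex_of_real t \<cdot>\<^sub>m mat1 u + complex_of_real (1 - t) \<cdot>\<^sub>m mat1 v"
  have l: "?l u v = mat1 (t * u + (1 - t) * v)" for u v by (rule mat1_eqI) auto
  \<comment> \<open>\<open>convex_onI\<close> attaches the weight \<open>t\<close> to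
    \<open>y\<close>, while the definition attaches it to the first matrix; hence \<open>y\<close>
    comes first.\<close>
  have "mat_psd (?l (f y) (f x) - mat_fc f (?l y x))"
    using assms t xy mat_pd_mat1[of x] mat_pd_mat1[of y] unfolding operator_convex_pos_def
    by (metis mat1_simps(1) mat_fc_mat1 greaterThan_iff less_imp_le)
  also have "?l (f y) (f x) - mat_fc f (?l y x) = mat1 (t * f y + (1 - t) * f x - f (t * y + (1 - t) * x))"
    unfolding l mat_fc_mat1 by (rule mat1_eqI) auto
  finally show "f ((1 - t) *\<^sub>R x + t *\<^sub>R y) \<le> (1 - t) * f x + t * f y"
    by (simp add: mat_psd_mat1_iff add.commute)
qed simp

text \<open>A convex function is continuous on the open half-line, and the right limit settles the
  point 0.\<close>

lemma operator_convex_pos_imp_continuous_on: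
  assumes "operator_convex_pos f" "(f \<longlongrightarrow> f 0) (at_right 0)"
  shows "continuous_on {0..} f"
  unfolding continuous_on_def
proof
  fix x :: real assume "x \<in> {0..}"
  show "(f \<longlongrightarrow> f x) (at x within {0..})"
  proof (cases "x = 0")
    case True
    then show ?thesis using assms(2) by (simp add: at_within_Ici_at_right)
  next
    case False
    have "continuous_on {0<..} f"
      using operator_convex_pos_imp_convex_on[OF assms(1)] by (intro convex_on_continuous) auto
    then have "isCont f x"
      using False \<open>x \<in> {0..}\<close> by (simp add: continuous_on_eq_continuous_at)
    then show ?thesis by (simp add: continuous_at_imp_continuous_at_within flip: continuous_within)
  qed
qed

subsection \<open>Convergence of perspectives\<close>

text \<open>The strong operator topology is the pullback along \<open>blinfun_apply\<close> of the
  product topology, in which convergence is pointwise.\<close>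

lemma limitin_strong_operator_topologyI:
  assumes "\<And>x. ((\<lambda>n. blinfun_apply (X n) x) \<longlongrightarrow> blinfun_apply W x) F"
  shows "limitin strong_operator_topology X W F"
proof -
  have "limitin (product_topology (\<lambda>_. euclidean) UNIV) (\<lambda>n. blinfun_apply (X n)) (blinfun_apply W) F"
    unfolding limitin_componentwise by (simp add: assms)
  then have "limitin euclidean (\<lambda>n. blinfun_apply (X n)) (blinfun_apply W) F"
    by (simp add: euclidean_product_topology)
  then show ?thesis
    unfolding limitin_def strong_operator_topology_def
    by (auto simp: openin_pullback_topology topspace_pullback_topology)
qed

text \<open>With \<open>R\<close> the inverse square root of \<open>C\<close>, the squared norm of
  \<open>op_sqrt B (R x)\<close> is the form of \<open>B\<close> at \<open>R x\<close>, at most the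
  form of \<open>C\<close> there, which is the squared norm of \<open>x\<close>. The second bound is
  the adjoint one.\<close>

lemma norm_op_sqrt_op_inv_le:
  fixes B C :: "'a::{real_inner,complete_space} \<Rightarrow>\<^sub>L 'a"
  assumes B: "pos_op B" and C: "numrange_in C d b" "d > 0" and le: "\<And>x. inner (B x) x \<le> inner (C x) x"
  shows "norm (op_sqrt B (op_inv (op_sqrt C) x)) \<le> norm x"
    and "norm (op_inv (op_sqrt C) (op_sqrt B x)) \<le> norm x"
proof -
  let ?R = "op_inv (op_sqrt C)"
  have pC: "pos_op C"
    using C unfolding pos_op_def numrange_in_def by (meson less_imp_le mult_nonneg_nonneg order_trans zero_le_power2)
  show *: "norm (op_sqrt B (?R x)) \<le> norm x" for x
  proof (rule power2_le_imp_le)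
    have "(norm (op_sqrt B (?R x)))\<^sup>2 \<le> inner (C (?R x)) (?R x)"
      using le[of "?R x"] by (simp add: norm_op_sqrt_apply[OF B])
    also have "\<dots> = (norm (op_sqrt C (?R x)))\<^sup>2" by (rule norm_op_sqrt_apply[OF pC, symmetric])
    finally show "(norm (op_sqrt B (?R x)))\<^sup>2 \<le> (norm x)\<^sup>2" by (simp add: op_inv_op_sqrt_right[OF C])
  qed simp
  show "norm (?R (op_sqrt B x)) \<le> norm x"
    using norm_selfadj_swap[OF selfadj_op_sqrt[OF B] selfadj_op_inv_op_sqrt[OF C], of 1 x] * by simp
qed

lemma tendsto_op_inv_op_sqrt:
  fixes B :: "'a::{real_inner,complete_space} \<Rightarrow>\<^sub>L 'a"
  assumes B: "pos_op B" and C: "\<forall>\<^sub>F n in F. \<exists>d b. numrange_in (C n) d b \<and> d > 0 \<and> (\<forall>x. inner (B x) x \<le> inner (C n x) x)"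
    and lim: "\<And>x. ((\<lambda>n. op_sqrt (C n) x) \<longlongrightarrow> op_sqrt B x) F"
    and y: "y \<in> closure (range (blinfun_apply B))"
  shows "((\<lambda>n. op_sqrt B (op_inv (op_sqrt (C n)) y)) \<longlongrightarrow> y) F"
    and "((\<lambda>n. op_inv (op_sqrt (C n)) (op_sqrt B y)) \<longlongrightarrow> y) F"
proof -
  let ?Q = "op_sqrt B" and ?R = "\<lambda>n. op_inv (op_sqrt (C n))"
  have bQR: "\<forall>\<^sub>F n in F. norm (?Q o\<^sub>L ?R n) \<le> 1"
    using C
  proof eventually_elim
    case (elim n)
    then show ?case using norm_op_sqrt_op_inv_le(1)[OF B] by (intro norm_blinfun_bound) auto
  qed
  have "((\<lambda>n. (?Q o\<^sub>L ?R n) y) \<longlongrightarrow> id_blinfun y) F"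
  proof (rule tendsto_blinfun_apply_closure[OF bQR _ y])
    fix y assume "y \<in> range B"
    then obtain z where z: "y = ?Q z" using op_sqrt_op_sqrt[OF B] by (metis imageE)
    \<comment> \<open>Eventually \<open>?R n\<close> inverts \<open>op_sqrt (C n)\<close>, so
      \<open>?Q (?R n y) - ?Q z\<close> is a contraction applied to this difference, which tends to
      0.\<close>
    have "((\<lambda>n. ?Q z - op_sqrt (C n) z) \<longlongrightarrow> ?Q z - ?Q z) F" by (intro tendsto_diff lim tendsto_const)
    then have "((\<lambda>n. ?Q z - op_sqrt (C n) z) \<longlongrightarrow> 0) F" by simp
    from tendsto_blinfun_apply_bounded[OF bQR _ this, of 0]
    have "((\<lambda>n. (?Q o\<^sub>L ?R n) (?Q z - op_sqrt (C n) z) + ?Q z) \<longlongrightarrow> 0 + ?Q z) F"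
      by (intro tendsto_add tendsto_const) simp
    moreover have "\<forall>\<^sub>F n in F. (?Q o\<^sub>L ?R n) (?Q z - op_sqrt (C n) z) + ?Q z = (?Q o\<^sub>L ?R n) y"
      using C
    proof eventually_elim
      case (elim n)
      then obtain d b where "numrange_in (C n) d b" "d > 0" by blast
      from op_inv_op_sqrt_left[OF this] show ?case by (simp add: z blinfun.diff_right)
    qed
    ultimately show "((\<lambda>n. (?Q o\<^sub>L ?R n) y) \<longlongrightarrow> id_blinfun y) F"
      using z by (simp add: tendsto_cong)
  qed
  then show QR: "((\<lambda>n. ?Q (?R n y)) \<longlongrightarrow> y) F" by simp
  have "((\<lambda>n. ?R n (?Q y) - y) \<longlongrightarrow> 0) F"
  proof (rule Lim_null_comparison)
    show "\<forall>\<^sub>F n in F. norm (?R n (?Q y) - y) \<le> sqrt (2 * inner y (y - ?Q (?R n y)))"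
      using C
    proof eventually_elim
      case (elim n)
      then obtain d b where Cn: "numrange_in (C n) d b" "d > 0" and le: "\<And>x. inner (B x) x \<le> inner (C n x) x" by blast
      have "(norm (?R n (?Q y)))\<^sup>2 \<le> (norm y)\<^sup>2"
        by (intro power_mono norm_op_sqrt_op_inv_le(2)[OF B Cn le]) auto
      moreover have "inner (?R n (?Q y)) y = inner y (?Q (?R n y))"
        using selfadj_op_inv_op_sqrt[OF Cn] selfadj_op_sqrt[OF B] by (metis selfadj_def)
      \<comment> \<open>Expand the square; the contraction bound replaces the squared norm of
        \<open>?R n (?Q y)\<close> by that of \<open>y\<close>.\<close>
      ultimately have "(norm (?R n (?Q y) - y))\<^sup>2 \<le> 2 * inner y (y - ?Q (?R n y))"
        unfolding power2_norm_eq_inner by (simp add: inner_diff_left inner_diff_right inner_commute)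
      then show ?case by (rule real_le_rsqrt)
    qed
    have "((\<lambda>n. sqrt (2 * inner y (y - ?Q (?R n y)))) \<longlongrightarrow> sqrt (2 * inner y (y - y))) F"
      by (intro tendsto_real_sqrt tendsto_mult tendsto_inner tendsto_diff tendsto_const QR)
    then show "((\<lambda>n. sqrt (2 * inner y (y - ?Q (?R n y)))) \<longlongrightarrow> 0) F" by simp
  qed
  then show "((\<lambda>n. ?R n (?Q y)) \<longlongrightarrow> y) F" by (simp add: LIM_zero_iff)
qed

text \<open>The filter is arbitrary and the conditions on \<open>L\<close> hold eventually, so that
  sequences and the limit from the right at 0 are both instances.\<close>

lemma persp_tendsto:
  fixes A B :: "'a::{real_inner,complete_space} \<Rightarrow>\<^sub>L 'a" and L :: "'b \<Rightarrow> 'a \<Rightarrow>\<^sub>L 'a"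
  assumes f: "continuous_on {0..} f" and A: "pos_op A" and B: "pos_op B" and "0 \<le> c"
    and le: "\<And>x. inner (A x) x \<le> c * inner (B x) x"
    and L: "\<forall>\<^sub>F n in F. pos_op (L n) \<and> op_invertible (L n)" and L0: "((\<lambda>n. norm (L n)) \<longlongrightarrow> 0) F"
  shows "((\<lambda>n. persp f A (B + L n) x) \<longlongrightarrow> (op_sqrt B o\<^sub>L op_fc f (Dquot A B) o\<^sub>L op_sqrt B) x) F"
proof -
  define D where "D = Dquot A B"
  let ?Q = "op_sqrt B" and ?s = "supp_proj B"
  define C where "C n = B + L n" for n
  define S where "S n = op_sqrt (C n)" for n
  define R where "R n = op_inv (S n)" for n
  define T where "T n = R n o\<^sub>L A o\<^sub>L R n" for n
  \<comment> \<open>Since \<open>norm (L n) < 1\<close> eventually, \<open>{0..M}\<close> is a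
    common interval for \<open>B\<close> and the \<open>C n\<close>; \<open>{0..K}\<close> will be
    one for \<open>D\<close> and the \<open>T n\<close>.\<close>
  define M where "M = norm B + 1"
  define K where "K = norm D"
  let ?H = "closure (range (blinfun_apply B))"
  have pD: "pos_op D" unfolding D_def by (rule pos_op_Dquot[OF A B \<open>0 \<le> c\<close> le])
  have A_eq: "A x = ?Q (D (?Q x))" for x
    using arg_cong[OF Dquot_eq[OF A B \<open>0 \<le> c\<close> le], of "\<lambda>S. blinfun_apply S x"] by (simp add: D_def)
  have Ds: "D (?s x) = D x" for x
    using arg_cong[OF Dquot_supp[OF A B \<open>0 \<le> c\<close> le], of "\<lambda>S. blinfun_apply S x"]
    by (simp add: D_def blinfun.diff_left blinfun.diff_right)
  have sH: "?s x \<in> ?H" for x using range_supp_proj[OF B] by auto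
  \<comment> \<open>The adjoint of \<open>D s = D\<close>; it puts the range of \<open>D\<close>
    into \<open>?H\<close>.\<close>
  have "?s (D x) = D x" for x
  proof (rule vector_eq_ldot[THEN iffD1], intro allI)
    fix y show "inner y (?s (D x)) = inner y (D x)"
      using pos_op_selfadj[OF pD] selfadj_supp_proj[OF B] Ds by (metis selfadj_def)
  qed
  then have DH: "D x \<in> ?H" for x using sH by metis
  have QH: "?Q x \<in> ?H" for x using sH op_sqrt_supp_proj(2)[OF B] by metis
  have L1: "\<forall>\<^sub>F n in F. norm (L n) < 1"
    using order_tendstoD(2)[OF L0, of 1] by simp
  have C: "\<forall>\<^sub>F n in F. (\<exists>d b. numrange_in (C n) d b \<and> d > 0 \<and> (\<forall>x. inner (B x) x \<le> inner (C n x) x))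
      \<and> numrange_in (C n) 0 M"
    using L L1
  proof eventually_elim
    case (elim n)
    \<comment> \<open>The lower bound \<open>d\<close> may depend on \<open>n\<close>: it serves the
      inverse of the square root, while uniform estimates use \<open>{0..M}\<close>.\<close>
    then obtain d where d: "d > 0" "\<And>x. d * (norm x)\<^sup>2 \<le> inner (L n x) x"
      using pos_op_invertible_coercive by blast
    have Cx: "inner (C n x) x = inner (B x) x + inner (L n x) x" for x
      by (simp add: C_def blinfun.add_left inner_add_left)
    have pC: "pos_op (C n)"
      unfolding pos_op_def Cx using elim B by (auto simp: C_def pos_op_def intro: selfadj_add)
    have nC: "norm (C n) \<le> M"
      using elim norm_triangle_ineq[of B "L n"] by (simp add: C_def M_def)
    have "d * (norm x)\<^sup>2 \<le> inner (C n x) x" for x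
      using d(2)[of x] B unfolding Cx pos_op_def by (smt (verit))
    then have "numrange_in (C n) d M"
      using numrange_in_pos_op[OF pC nC] by (simp add: numrange_in_def)
    moreover have "inner (B x) x \<le> inner (C n x) x" for x
      unfolding Cx using elim by (simp add: pos_op_def)
    ultimately show ?case using d(1) numrange_in_pos_op[OF pC nC] by blast
  qed
  then have C1: "\<forall>\<^sub>F n in F. \<exists>d b. numrange_in (C n) d b \<and> d > 0 \<and> (\<forall>x. inner (B x) x \<le> inner (C n x) x)"
    and C2: "\<forall>\<^sub>F n in F. numrange_in (C n) 0 M" by (auto simp: eventually_conj_iff)
  have cs: "continuous_on {0..M} sqrt" by (intro continuous_intros)
  have "(L \<longlongrightarrow> 0) F" using L0 by (simp add: tendsto_norm_zero_iff)
  from tendsto_add[OF tendsto_const this, of B] have "(C \<longlongrightarrow> B) F" by (simp add: C_def[abs_def])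
  then have Cx: "((\<lambda>n. C n x) \<longlongrightarrow> B x) F" for x by (rule blinfun.tendsto[OF _ tendsto_const])
  have "((\<lambda>n. op_fc sqrt (C n) x) \<longlongrightarrow> op_fc sqrt B x) F" for x
    by (rule op_fc_strong_limit[where H = UNIV, OF numrange_in_pos_op[OF B] cs C2])
      (simp_all add: M_def Cx)
  then have S: "((\<lambda>n. S n x) \<longlongrightarrow> ?Q x) F" for x by (simp add: S_def op_sqrt_def)
  note QR = tendsto_op_inv_op_sqrt(1)[OF B C1, folded S_def R_def, OF S]
  note RQ = tendsto_op_inv_op_sqrt(2)[OF B C1, folded S_def R_def, OF S]
  have contr: "\<forall>\<^sub>F n in F. selfadj (R n) \<and> (\<forall>x. norm (?Q (R n x)) \<le> norm x) \<and> (\<forall>x. norm (R n (?Q x)) \<le> norm x)"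
    using C1
  proof eventually_elim
    case (elim n)
    then obtain d b where Cn: "numrange_in (C n) d b" "d > 0" and le: "\<And>x. inner (B x) x \<le> inner (C n x) x" by blast
    show ?case
      unfolding R_def S_def using selfadj_op_inv_op_sqrt[OF Cn] norm_op_sqrt_op_inv_le[OF B Cn le] by blast
  qed
  have bRQ: "\<forall>\<^sub>F n in F. norm (R n o\<^sub>L ?Q) \<le> 1"
    using contr by eventually_elim (auto intro!: norm_blinfun_bound)
  \<comment> \<open>The factorization of \<open>T n\<close> as \<open>V\<close>, then
    \<open>D\<close>, then the adjoint of \<open>V\<close>, with \<open>V = R n Q\<close>.\<close>
  have T_eq: "T n y = (R n o\<^sub>L ?Q) (D (?Q (R n y)))" for n y by (simp add: T_def A_eq)
  have T: "((\<lambda>n. T n y) \<longlongrightarrow> D y) F" if "y \<in> ?H" for y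
  proof -
    have "((\<lambda>n. (R n o\<^sub>L ?Q) (D y)) \<longlongrightarrow> D y) F" using RQ[OF DH] by simp
    moreover have "((\<lambda>n. D (?Q (R n y))) \<longlongrightarrow> D y) F"
      by (rule blinfun.tendsto[OF tendsto_const QR[OF that]])
    ultimately show ?thesis unfolding T_eq by (rule tendsto_blinfun_apply_bounded[OF bRQ])
  qed
  have nD: "numrange_in D 0 K" unfolding K_def by (rule numrange_in_pos_op[OF pD order_refl])
  \<comment> \<open>The form of \<open>T n\<close> at \<open>x\<close> is that of \<open>D\<close>
    at \<open>?Q (R n x)\<close>, whose norm is at most \<open>norm x\<close>; hence
    \<open>T n\<close> keeps the bounds 0 and \<open>K\<close> of \<open>D\<close>.\<close>
  have nT: "\<forall>\<^sub>F n in F. numrange_in (T n) 0 K"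
    using contr
  proof eventually_elim
    case (elim n)
    have Tn: "inner (T n x) x = inner (D (?Q (R n x))) (?Q (R n x))" for x
    proof -
      have "inner (T n x) x = inner (?Q (D (?Q (R n x)))) (R n x)"
        using elim by (simp add: T_eq selfadjD)
      then show ?thesis by (simp add: selfadjD[OF selfadj_op_sqrt[OF B]])
    qed
    have "inner (T n x) x \<le> K * (norm x)\<^sup>2" for x
    proof -
      have "inner (T n x) x \<le> K * (norm (?Q (R n x)))\<^sup>2"
        using nD unfolding Tn numrange_in_def by blast
      also have "\<dots> \<le> K * (norm x)\<^sup>2"
        using elim by (intro mult_left_mono power_mono) (auto simp: K_def)
      finally show ?thesis .
    qed
    moreover have "0 \<le> inner (T n x) x" for x using pD unfolding Tn pos_op_def by blast
    moreover have "selfadj (T n)"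
      unfolding T_def using elim pos_op_selfadj[OF A] by (intro selfadj_sandwich) auto
    ultimately show ?case by (simp add: numrange_in_def)
  qed
  have cf: "continuous_on {0..K} f" using f by (rule continuous_on_subset) auto
  have fT: "((\<lambda>n. op_fc f (T n) (?Q x)) \<longlongrightarrow> op_fc f D (?Q x)) F"
    by (rule op_fc_strong_limit[where H = ?H, OF nD cf nT DH T QH])
  obtain N where N: "\<And>t. t \<in> {0..K} \<Longrightarrow> \<bar>f t\<bar> \<le> N"
    using compact_imp_bounded[OF compact_continuous_image[OF cf compact_Icc]]
    by (metis bounded_iff imageI real_norm_def)
  have bfT: "\<forall>\<^sub>F n in F. norm (op_fc f (T n)) \<le> max 0 N"
    using nT by eventually_elim (rule norm_op_fc_le[OF _ cf], auto intro: order_trans[OF N])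
  \<comment> \<open>The uniform bound on \<open>op_fc f (T n)\<close> allows evaluation at the
    moving vector \<open>S n x\<close> instead of its limit \<open>?Q x\<close>; the outer factor
    \<open>S n\<close> is handled in the same way.\<close>
  have fTS: "((\<lambda>n. op_fc f (T n) (S n x)) \<longlongrightarrow> op_fc f D (?Q x)) F"
    by (rule tendsto_blinfun_apply_bounded[OF bfT fT S])
  have bS: "\<forall>\<^sub>F n in F. norm (S n) \<le> sqrt M"
    using C2 unfolding S_def op_sqrt_def
    by eventually_elim (rule norm_op_fc_le[OF _ cs], auto simp: M_def)
  have "((\<lambda>n. S n (op_fc f (T n) (S n x))) \<longlongrightarrow> ?Q (op_fc f D (?Q x))) F"
    by (rule tendsto_blinfun_apply_bounded[OF bS S fTS])
  then show ?thesis by (simp add: persp_def T_def R_def S_def C_def D_def)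
qed

theorem theorem6p3:
  fixes f :: "real \<Rightarrow> real" and A B :: "'a::{real_inner,complete_space} \<Rightarrow>\<^sub>L 'a" and c :: real
  assumes "operator_convex_pos f"
    and "(f \<longlongrightarrow> f 0) (at_right 0)"
    and "pos_op A" and "pos_op B" and "c > 0" and "op_le A (c *\<^sub>R B)"
  shows "(\<forall>L :: nat \<Rightarrow> ('a \<Rightarrow>\<^sub>L 'a).
            (\<forall>n. pos_op (L n) \<and> op_invertible (L n)) \<and> (\<lambda>n. norm (L n)) \<longlonglongrightarrow> 0
            \<longrightarrow> limitin strong_operator_topology (\<lambda>n. persp f A (B + L n))
                  (op_sqrt B o\<^sub>L op_fc f (Dquot A B) o\<^sub>L op_sqrt B) sequentially)
       \<and> limitin strong_operator_topology (\<lambda>\<epsilon>. persp f A (B + \<epsilon> *\<^sub>R id_blinfun))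
                  (op_sqrt B o\<^sub>L op_fc f (Dquot A B) o\<^sub>L op_sqrt B) (at_right 0)"
proof -
  have le: "inner (A x) x \<le> c * inner (B x) x" for x
    using assms(6) by (simp add: op_le_def pos_op_def blinfun.diff_left blinfun.scaleR_left inner_diff_left)
  note main = persp_tendsto[OF operator_convex_pos_imp_continuous_on[OF assms(1,2)] assms(3,4)
      less_imp_le[OF assms(5)] le]
  show ?thesis
  proof (intro conjI allI impI; (elim conjE)?)
    fix L :: "nat \<Rightarrow> 'a \<Rightarrow>\<^sub>L 'a"
    assume "\<forall>n. pos_op (L n) \<and> op_invertible (L n)" "(\<lambda>n. norm (L n)) \<longlonglongrightarrow> 0"
    then show "limitin strong_operator_topology (\<lambda>n. persp f A (B + L n))
        (op_sqrt B o\<^sub>L op_fc f (Dquot A B) o\<^sub>L op_sqrt B) sequentially"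
      by (intro limitin_strong_operator_topologyI main always_eventually)
  next
    show "limitin strong_operator_topology (\<lambda>\<epsilon>. persp f A (B + \<epsilon> *\<^sub>R id_blinfun))
        (op_sqrt B o\<^sub>L op_fc f (Dquot A B) o\<^sub>L op_sqrt B) (at_right 0)"
    \<comment> \<open>The perturbation is now \<open>e\<close> times the identity, positive and
      invertible for \<open>e > 0\<close>, that is, eventually to the right of 0.\<close>
    proof (intro limitin_strong_operator_topologyI main)
      have "pos_op (e *\<^sub>R id_blinfun :: 'a \<Rightarrow>\<^sub>L 'a) \<and> op_invertible (e *\<^sub>R id_blinfun :: 'a \<Rightarrow>\<^sub>L 'a)"
        if "e > 0" for e
      proof
        show "pos_op (e *\<^sub>R id_blinfun :: 'a \<Rightarrow>\<^sub>L 'a)"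
          using that by (simp add: pos_op_def selfadj_scaleR selfadj_id blinfun.scaleR_left)
        show "op_invertible (e *\<^sub>R id_blinfun :: 'a \<Rightarrow>\<^sub>L 'a)"
          unfolding op_invertible_def using that
          by (intro exI[of _ "inverse e *\<^sub>R id_blinfun"]) (auto intro!: blinfun_eqI simp: blinfun.bilinear_simps)
      qed
      then show "\<forall>\<^sub>F e in at_right 0. pos_op (e *\<^sub>R id_blinfun :: 'a \<Rightarrow>\<^sub>L 'a) \<and>
          op_invertible (e *\<^sub>R id_blinfun :: 'a \<Rightarrow>\<^sub>L 'a)"
        by (auto simp: eventually_at_right_less intro: eventually_mono[OF eventually_at_right_less])
      have "((\<lambda>e. norm (e *\<^sub>R id_blinfun :: 'a \<Rightarrow>\<^sub>L 'a)) \<longlongrightarrow> norm (0 *\<^sub>R id_blinfun :: 'a \<Rightarrow>\<^sub>L 'a)) (at_right 0)"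
        by (intro tendsto_norm tendsto_scaleR tendsto_ident_at tendsto_const)
      then show "((\<lambda>e. norm (e *\<^sub>R id_blinfun :: 'a \<Rightarrow>\<^sub>L 'a)) \<longlongrightarrow> 0) (at_right 0)" by simp
    qed
  qed
qed

end
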